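(* Let $(\overline M,\overline J,\overline g,\overline{\widetilde g})$ be a $2n$-dimensional almost complex manifold with Norden metric and let $M$ be an $m$-dimensional submanifold of $\overline M$, $m>1$, with induced tensor fields $g=\overline g|_{TM}$ and $\widetilde g=\overline{\widetilde g}|_{TM}$. Then: (1) If $1<m<n$, then $(M,g)$ is totally real if and only if $(M,\widetilde g)$ is an isotropic submanifold (with respect to $\overline{\widetilde g}$) such that $\overline J(TM)=\mathrm{ltr}(TM)$. (2) $(M,g)$ is Lagrangian if and only if $(M,\widetilde g)$ is a totally lightlike submanifold (with respect to $\overline{\widetilde g}$) such that $\overline J(TM)=\mathrm{ltr}(TM)$.
   Context: An almost complex manifold with Norden metric is a smooth $2n$-dimensional manifold $\overline M$ with an almost complex structure $\overline J$ ($\overline J^2=-\mathrm{Id}$) and a semi-Riemannian metric $\overline g$ such that $\overline g(\overline JX,\overline JY)=-\overline g(X,Y)$ for all vector fields $X,Y$. The associated metric is $\overline{\widetilde g}(X,Y)=\overline g(\overline JX,Y)$; it is also a Norden metric, and both metrics have signature $(n,n)$. $(M,g)$ is totally real if $g$ is non-degenerate on $TM$ and $\overline J(T_xM)\subseteq T_xM^\bot$ for all $x\in M$, where $TM^\bot$ is the normal bundle with respect to $\overline g$ (then $m\le n$). A totally real submanifold is Lagrangian if $m=n$. Lightlike submanifolds with respect to $\overline{\widetilde g}$: let $TM^{\widetilde\bot}$ be the orthogonal bundle of $TM$ in $T\overline M|_M$ with respect to $\overline{\widetilde g}$, $\mathrm{Rad}\,T_xM=T_xM\cap T_xM^{\widetilde\bot}$,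 assumed of constant rank $r>0$. $(M,\widetilde g)$ is isotropic if $1<r=m<\mathrm{codim}\,M=2n-m$ (so $\mathrm{Rad}\,TM=TM\subset TM^{\widetilde\bot}$ and the screen distribution is $S(TM)=\{0\}$), and totally lightlike if $1<r=m=\mathrm{codim}\,M$ (so $TM=TM^{\widetilde\bot}$ and both $S(TM)$ and $S(TM^{\widetilde\bot})$ are $\{0\}$). In these cases a screen transversal bundle $S(TM^{\widetilde\bot})$ is a complement of $TM$ in $TM^{\widetilde\bot}$ (it is non-degenerate for $\overline{\widetilde g}$), and a lightlike transversal bundle $\mathrm{ltr}(TM)$ is a complement of $\mathrm{Rad}\,TM=TM$ in the $\overline{\widetilde g}$-orthogonal complement of $S(TM^{\widetilde\bot})$ in $T\overline M|_M$ that is totally null for $\overline{\widetilde g}$. The condition $\overline J(TM)=\mathrm{ltr}(TM)$ means that it holds for some choice of $S(TM^{\widetilde\bot})$ and $\mathrm{ltr}(TM)$. *)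

theory Defs
  imports "HOL-Analysis.Analysis"
begin

section \<open>Smooth maps between Euclidean spaces\<close>

text \<open>
  Only used for open \<open>S\<close>, where \<open>at x\<close> is the same filter as \<open>at x within S\<close>.
  All directional derivatives of order less than \<open>k\<close> are differentiable on \<open>S\<close>, and those of
  order \<open>k\<close> are continuous.
\<close>

primrec Ck_on :: "nat \<Rightarrow> 'e set \<Rightarrow> ('e::euclidean_space \<Rightarrow> 'f::euclidean_space) \<Rightarrow> bool" where
  "Ck_on 0 S f \<longleftrightarrow> continuous_on S f"
| "Ck_on (Suc k) S f \<longleftrightarrow> (\<forall>x\<in>S. f differentiable (at x)) \<and>
     (\<forall>v. Ck_on k S (\<lambda>x. frechet_derivative f (at x) v))"

definition smooth_on :: "'e set \<Rightarrow> ('e::euclidean_space \<Rightarrow> 'f::euclidean_space) \<Rightarrow> bool" where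
  "smooth_on S f \<longleftrightarrow> (\<forall>k. Ck_on k S f)"


section \<open>Smooth manifolds\<close>

text \<open>
  A manifold modelled on \<open>'e\<close> is a topological space (on a carrier that may be a proper subset
  of the type \<open>'a\<close>) with an atlas, not necessarily maximal; a chart is its domain together with
  its coordinate map.
\<close>

type_synonym ('a, 'e) chart = "'a set \<times> ('a \<Rightarrow> 'e)"

abbreviation chart_dom :: "('a, 'e) chart \<Rightarrow> 'a set" where "chart_dom \<equiv> fst"
abbreviation chart_map :: "('a, 'e) chart \<Rightarrow> 'a \<Rightarrow> 'e" where "chart_map \<equiv> snd"

definition chart_inv :: "('a, 'e) chart \<Rightarrow> 'e \<Rightarrow> 'a" where
  "chart_inv c = inv_into (chart_dom c) (chart_map c)"

record ('a, 'e) manifold =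
  mtop :: "'a topology"
  atlas :: "('a, 'e) chart set"

abbreviation points :: "('a, 'e) manifold \<Rightarrow> 'a set" where
  "points M \<equiv> topspace (mtop M)"

definition mdim :: "('a, 'e::euclidean_space) manifold \<Rightarrow> nat" where
  "mdim M = DIM('e)"

text \<open>The expression of \<open>f\<close> in the charts \<open>c\<close> and \<open>d\<close>; for \<open>f = id\<close>, the change of coordinates.\<close>

definition local_rep :: "('a, 'e) chart \<Rightarrow> ('a \<Rightarrow> 'b) \<Rightarrow> ('b, 'f) chart \<Rightarrow> 'e \<Rightarrow> 'f" where
  "local_rep c f d = chart_map d \<circ> f \<circ> chart_inv c"

definition smooth_manifold :: "('a, 'e::euclidean_space) manifold \<Rightarrow> bool" where
  "smooth_manifold M \<longleftrightarrow>
     Hausdorff_space (mtop M) \<and> second_countable (mtop M) \<and>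
     points M = (\<Union>c\<in>atlas M. chart_dom c) \<and>
     (\<forall>c\<in>atlas M. openin (mtop M) (chart_dom c) \<and> open (chart_map c ` chart_dom c) \<and>
        homeomorphic_map (subtopology (mtop M) (chart_dom c))
          (top_of_set (chart_map c ` chart_dom c)) (chart_map c)) \<and>
     (\<forall>c\<in>atlas M. \<forall>d\<in>atlas M.
        smooth_on (chart_map c ` (chart_dom c \<inter> chart_dom d)) (local_rep c id d))"

definition smooth_map ::
    "('a, 'e::euclidean_space) manifold \<Rightarrow> ('b, 'f::euclidean_space) manifold \<Rightarrow> ('a \<Rightarrow> 'b) \<Rightarrow> bool" where
  "smooth_map M N f \<longleftrightarrow> continuous_map (mtop M) (mtop N) f \<and>
     (\<forall>c\<in>atlas M. \<forall>d\<in>atlas N.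
        smooth_on (chart_map c ` (chart_dom c \<inter> f -` chart_dom d)) (local_rep c f d))"


section \<open>Tangent vectors and differentials\<close>

text \<open>
  A tangent vector at \<open>x\<close> is determined by its components in any one chart around \<open>x\<close>; the
  components in two charts are related by the derivative of the change of coordinates.
  We represent it by its components in a chart \<open>chart_at M x\<close> around \<open>x\<close> chosen once and for all,
  so that the tangent space of \<open>M\<close> at every point is the vector space \<open>'e\<close>.  The chosen chart
  need not vary continuously with \<open>x\<close>, so smoothness of a field is always expressed through
  its components in a fixed chart, \<open>components M x d v\<close>.
\<close>

definition chart_at :: "('a, 'e) manifold \<Rightarrow> 'a \<Rightarrow> ('a, 'e) chart" where
  "chart_at M x = (SOME c. c \<in> atlas M \<and> x \<in> chart_dom c)"

definition components ::
    "('a, 'e::euclidean_space) manifold \<Rightarrow> 'a \<Rightarrow> ('a, 'e) chart \<Rightarrow> 'e \<Rightarrow> 'e" where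
  "components M x d v =
     frechet_derivative (local_rep (chart_at M x) id d) (at (chart_map (chart_at M x) x)) v"

definition differential ::
    "('a, 'e::euclidean_space) manifold \<Rightarrow> ('b, 'f::euclidean_space) manifold \<Rightarrow>
     ('a \<Rightarrow> 'b) \<Rightarrow> 'a \<Rightarrow> 'e \<Rightarrow> 'f" where
  "differential M N f x =
     frechet_derivative (local_rep (chart_at M x) f (chart_at N (f x)))
       (at (chart_map (chart_at M x) x))"

text \<open>
  Submanifolds are immersed: \<open>M\<close> is a subset of \<open>N\<close> with a smooth structure of its own (whose
  topology may be finer than the subspace topology) for which the inclusion is a smooth immersion.
  The tangent space of \<open>M\<close> at \<open>x\<close> is identified with its image in the tangent space of \<open>N\<close>.
\<close>

definition submanifold ::
    "('a, 'f::euclidean_space) manifold \<Rightarrow> ('a, 'e::euclidean_space) manifold \<Rightarrow> bool" where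
  "submanifold M N \<longleftrightarrow> smooth_manifold M \<and> points M \<subseteq> points N \<and> smooth_map M N id \<and>
     (\<forall>x\<in>points M. inj (differential M N id x))"

definition tangent ::
    "('a, 'f::euclidean_space) manifold \<Rightarrow> ('a, 'e::euclidean_space) manifold \<Rightarrow> 'a \<Rightarrow> 'e set" where
  "tangent M N x = range (differential M N id x)"


section \<open>Smooth fields and bundles\<close>

definition smooth_function_on ::
    "('a, 'e::euclidean_space) manifold \<Rightarrow> 'a set \<Rightarrow> ('a \<Rightarrow> real) \<Rightarrow> bool" where
  "smooth_function_on M U f \<longleftrightarrow>
     (\<forall>c\<in>atlas M. smooth_on (chart_map c ` (U \<inter> chart_dom c)) (f \<circ> chart_inv c))"

text \<open>
  \<open>V\<close> is a smooth section of the restriction of the tangent bundle of \<open>N\<close> to the open subset \<open>U\<close>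
  of the submanifold \<open>M\<close>.  For \<open>M = N\<close> this is a smooth vector field on \<open>U\<close>.
\<close>

definition smooth_along ::
    "('a, 'f::euclidean_space) manifold \<Rightarrow> ('a, 'e::euclidean_space) manifold \<Rightarrow>
     'a set \<Rightarrow> ('a \<Rightarrow> 'e) \<Rightarrow> bool" where
  "smooth_along M N U V \<longleftrightarrow>
     (\<forall>c\<in>atlas M. \<forall>d\<in>atlas N.
        smooth_on (chart_map c ` (U \<inter> chart_dom c \<inter> chart_dom d))
          (\<lambda>y. components N (chart_inv c y) d (V (chart_inv c y))))"

abbreviation smooth_vector_field_on ::
    "('a, 'e::euclidean_space) manifold \<Rightarrow> 'a set \<Rightarrow> ('a \<Rightarrow> 'e) \<Rightarrow> bool" where
  "smooth_vector_field_on N \<equiv> smooth_along N N"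

definition smooth_tensor_1_1 ::
    "('a, 'e::euclidean_space) manifold \<Rightarrow> ('a \<Rightarrow> 'e \<Rightarrow> 'e) \<Rightarrow> bool" where
  "smooth_tensor_1_1 N J \<longleftrightarrow> (\<forall>x\<in>points N. linear (J x)) \<and>
     (\<forall>U X. openin (mtop N) U \<and> smooth_vector_field_on N U X \<longrightarrow>
        smooth_vector_field_on N U (\<lambda>x. J x (X x)))"

definition smooth_tensor_0_2 ::
    "('a, 'e::euclidean_space) manifold \<Rightarrow> ('a \<Rightarrow> 'e \<Rightarrow> 'e \<Rightarrow> real) \<Rightarrow> bool" where
  "smooth_tensor_0_2 N g \<longleftrightarrow> (\<forall>x\<in>points N. bilinear (g x)) \<and>
     (\<forall>U X Y. openin (mtop N) U \<and> smooth_vector_field_on N U X \<and> smooth_vector_field_on N U Y \<longrightarrow>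
        smooth_function_on N U (\<lambda>x. g x (X x) (Y x)))"

text \<open>
  Smooth vector subbundles of the restriction of the tangent bundle of \<open>N\<close> to \<open>M\<close>, given by their
  fibres: near each point there is a smooth frame of constant length \<open>k\<close> (\<open>k = 0\<close> is allowed).
\<close>

definition smooth_subbundle ::
    "('a, 'f::euclidean_space) manifold \<Rightarrow> ('a, 'e::euclidean_space) manifold \<Rightarrow>
     ('a \<Rightarrow> 'e set) \<Rightarrow> bool" where
  "smooth_subbundle M N E \<longleftrightarrow>
     (\<exists>k. \<forall>x\<in>points M. \<exists>U (B :: nat \<Rightarrow> 'a \<Rightarrow> 'e). openin (mtop M) U \<and> x \<in> U \<and>
        (\<forall>i<k. smooth_along M N U (B i)) \<and>
        (\<forall>y\<in>U. inj_on (\<lambda>i. B i y) {..<k} \<and> independent ((\<lambda>i. B i y) ` {..<k}) \<and>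
           span ((\<lambda>i. B i y) ` {..<k}) = E y))"


section \<open>Almost complex manifolds with Norden metric\<close>

definition orth :: "('e \<Rightarrow> 'e \<Rightarrow> real) \<Rightarrow> 'e set \<Rightarrow> 'e set" where
  "orth b W = {v. \<forall>w\<in>W. b v w = 0}"

definition nondegenerate_on :: "('e::zero \<Rightarrow> 'e \<Rightarrow> real) \<Rightarrow> 'e set \<Rightarrow> bool" where
  "nondegenerate_on b W \<longleftrightarrow> (\<forall>v\<in>W. (\<forall>w\<in>W. b v w = 0) \<longrightarrow> v = 0)"

definition neg_index :: "('e::euclidean_space \<Rightarrow> 'e \<Rightarrow> real) \<Rightarrow> nat" where
  "neg_index b = Max {dim W | W. subspace W \<and> (\<forall>w\<in>W. w \<noteq> 0 \<longrightarrow> b w w < 0)}"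

definition semi_riemannian_metric ::
    "('a, 'e::euclidean_space) manifold \<Rightarrow> ('a \<Rightarrow> 'e \<Rightarrow> 'e \<Rightarrow> real) \<Rightarrow> bool" where
  "semi_riemannian_metric N g \<longleftrightarrow> smooth_tensor_0_2 N g \<and>
     (\<forall>x\<in>points N. (\<forall>v w. g x v w = g x w v) \<and> nondegenerate_on (g x) UNIV) \<and>
     (\<exists>\<nu>. \<forall>x\<in>points N. neg_index (g x) = \<nu>)"

definition almost_complex_structure ::
    "('a, 'e::euclidean_space) manifold \<Rightarrow> ('a \<Rightarrow> 'e \<Rightarrow> 'e) \<Rightarrow> bool" where
  "almost_complex_structure N J \<longleftrightarrow> smooth_tensor_1_1 N J \<and>
     (\<forall>x\<in>points N. \<forall>v. J x (J x v) = - v)"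

definition almost_complex_norden_manifold ::
    "('a, 'e::euclidean_space) manifold \<Rightarrow> ('a \<Rightarrow> 'e \<Rightarrow> 'e) \<Rightarrow> ('a \<Rightarrow> 'e \<Rightarrow> 'e \<Rightarrow> real) \<Rightarrow> bool" where
  "almost_complex_norden_manifold N J g \<longleftrightarrow>
     smooth_manifold N \<and> almost_complex_structure N J \<and> semi_riemannian_metric N g \<and>
     (\<forall>x\<in>points N. \<forall>v w. g x (J x v) (J x w) = - g x v w)"

definition associated_metric ::
    "('a \<Rightarrow> 'e \<Rightarrow> 'e) \<Rightarrow> ('a \<Rightarrow> 'e \<Rightarrow> 'e \<Rightarrow> real) \<Rightarrow> 'a \<Rightarrow> 'e \<Rightarrow> 'e \<Rightarrow> real" where
  "associated_metric J g x v w = g x (J x v) w"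


section \<open>Totally real and Lagrangian submanifolds\<close>

definition totally_real ::
    "('a, 'f::euclidean_space) manifold \<Rightarrow> ('a, 'e::euclidean_space) manifold \<Rightarrow>
     ('a \<Rightarrow> 'e \<Rightarrow> 'e) \<Rightarrow> ('a \<Rightarrow> 'e \<Rightarrow> 'e \<Rightarrow> real) \<Rightarrow> bool" where
  "totally_real M N J g \<longleftrightarrow>
     (\<forall>x\<in>points M. nondegenerate_on (g x) (tangent M N x) \<and>
        J x ` tangent M N x \<subseteq> orth (g x) (tangent M N x))"

definition lagrangian ::
    "('a, 'f::euclidean_space) manifold \<Rightarrow> ('a, 'e::euclidean_space) manifold \<Rightarrow>
     ('a \<Rightarrow> 'e \<Rightarrow> 'e) \<Rightarrow> ('a \<Rightarrow> 'e \<Rightarrow> 'e \<Rightarrow> real) \<Rightarrow> bool" where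
  "lagrangian M N J g \<longleftrightarrow> totally_real M N J g \<and> 2 * mdim M = mdim N"


section \<open>Lightlike submanifolds\<close>

text \<open>Throughout, \<open>h\<close> is the ambient metric with respect to which \<open>M\<close> is lightlike.\<close>

definition tangent_orth ::
    "('a, 'f::euclidean_space) manifold \<Rightarrow> ('a, 'e::euclidean_space) manifold \<Rightarrow>
     ('a \<Rightarrow> 'e \<Rightarrow> 'e \<Rightarrow> real) \<Rightarrow> 'a \<Rightarrow> 'e set" where
  "tangent_orth M N h x = orth (h x) (tangent M N x)"

definition radical ::
    "('a, 'f::euclidean_space) manifold \<Rightarrow> ('a, 'e::euclidean_space) manifold \<Rightarrow>
     ('a \<Rightarrow> 'e \<Rightarrow> 'e \<Rightarrow> real) \<Rightarrow> 'a \<Rightarrow> 'e set" where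
  "radical M N h x = tangent M N x \<inter> tangent_orth M N h x"

definition lightlike ::
    "nat \<Rightarrow> ('a, 'f::euclidean_space) manifold \<Rightarrow> ('a, 'e::euclidean_space) manifold \<Rightarrow>
     ('a \<Rightarrow> 'e \<Rightarrow> 'e \<Rightarrow> real) \<Rightarrow> bool" where
  "lightlike r M N h \<longleftrightarrow> 0 < r \<and> (\<forall>x\<in>points M. dim (radical M N h x) = r)"

definition codim ::
    "('a, 'f::euclidean_space) manifold \<Rightarrow> ('a, 'e::euclidean_space) manifold \<Rightarrow> nat" where
  "codim M N = mdim N - mdim M"

definition isotropic ::
    "('a, 'f::euclidean_space) manifold \<Rightarrow> ('a, 'e::euclidean_space) manifold \<Rightarrow>
     ('a \<Rightarrow> 'e \<Rightarrow> 'e \<Rightarrow> real) \<Rightarrow> bool" where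
  "isotropic M N h \<longleftrightarrow> (\<exists>r. lightlike r M N h \<and> 1 < r \<and> r = mdim M \<and> mdim M < codim M N)"

definition totally_lightlike ::
    "('a, 'f::euclidean_space) manifold \<Rightarrow> ('a, 'e::euclidean_space) manifold \<Rightarrow>
     ('a \<Rightarrow> 'e \<Rightarrow> 'e \<Rightarrow> real) \<Rightarrow> bool" where
  "totally_lightlike M N h \<longleftrightarrow> (\<exists>r. lightlike r M N h \<and> 1 < r \<and> r = mdim M \<and> mdim M = codim M N)"

definition complement_in :: "'e::real_vector set \<Rightarrow> 'e set \<Rightarrow> 'e set \<Rightarrow> bool" where
  "complement_in A B C \<longleftrightarrow> subspace A \<and> A \<inter> B = {0} \<and> {a + b | a b. a \<in> A \<and> b \<in> B} = C"

text \<open>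
  The two transversal bundles in the case of a radical equal to the whole tangent bundle, that is,
  for isotropic and for totally lightlike submanifolds: the screen distribution is then zero.  A
  screen transversal fibre is automatically non-degenerate, because the radical of the orthogonal
  bundle is the tangent bundle; in the totally lightlike case it is zero.
\<close>

definition screen_transversal ::
    "('a, 'f::euclidean_space) manifold \<Rightarrow> ('a, 'e::euclidean_space) manifold \<Rightarrow>
     ('a \<Rightarrow> 'e \<Rightarrow> 'e \<Rightarrow> real) \<Rightarrow> ('a \<Rightarrow> 'e set) \<Rightarrow> bool" where
  "screen_transversal M N h S \<longleftrightarrow> smooth_subbundle M N S \<and>
     (\<forall>x\<in>points M. complement_in (S x) (tangent M N x) (tangent_orth M N h x))"

definition lightlike_transversal ::
    "('a, 'f::euclidean_space) manifold \<Rightarrow> ('a, 'e::euclidean_space) manifold \<Rightarrow>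
     ('a \<Rightarrow> 'e \<Rightarrow> 'e \<Rightarrow> real) \<Rightarrow> ('a \<Rightarrow> 'e set) \<Rightarrow> ('a \<Rightarrow> 'e set) \<Rightarrow> bool" where
  "lightlike_transversal M N h S L \<longleftrightarrow> smooth_subbundle M N L \<and>
     (\<forall>x\<in>points M. complement_in (L x) (tangent M N x) (orth (h x) (S x)) \<and>
        (\<forall>v\<in>L x. \<forall>w\<in>L x. h x v w = 0))"

definition J_tangent_is_ltr ::
    "('a, 'f::euclidean_space) manifold \<Rightarrow> ('a, 'e::euclidean_space) manifold \<Rightarrow>
     ('a \<Rightarrow> 'e \<Rightarrow> 'e) \<Rightarrow> ('a \<Rightarrow> 'e \<Rightarrow> 'e \<Rightarrow> real) \<Rightarrow> bool" where
  "J_tangent_is_ltr M N J h \<longleftrightarrow>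
     (\<exists>S L. screen_transversal M N h S \<and> lightlike_transversal M N h S L \<and>
        (\<forall>x\<in>points M. J x ` tangent M N x = L x))"

end

theory Submission
  imports Defs
begin

text \<open>
  Let \<open>h\<close> be the associated metric and \<open>T\<close> a tangent space of \<open>M\<close>.  From
  \<open>h v w = g (J v) w\<close> one gets \<open>h v (J w) = - g v w\<close> and \<open>h (J v) (J w) = - h v w\<close>.  So
  \<open>J T\<close> is \<open>g\<close>-orthogonal to \<open>T\<close> exactly when \<open>h\<close> vanishes on \<open>T\<close>, that is, when the radical
  has the dimension of \<open>T\<close>; then \<open>h\<close> vanishes on \<open>J T\<close> as well.  What remains is to match the
  non-degeneracy of \<open>g\<close> on \<open>T\<close>, which is the perfectness of the \<open>h\<close>-pairing of \<open>T\<close> with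
  \<open>J T\<close>, with the condition that \<open>J T\<close> is a lightlike transversal bundle.

  If \<open>g\<close> is non-degenerate on \<open>T\<close>, then \<open>T \<inter> J T = {0}\<close> and \<open>h\<close> is non-degenerate on
  \<open>T \<oplus> J T\<close>.  The orthogonal space \<open>S\<close> of \<open>T \<oplus> J T\<close> is then a complement of \<open>T\<close> in its
  orthogonal space, and \<open>J T\<close> is a complement of \<open>T\<close> in the orthogonal space \<open>T \<oplus> J T\<close> of \<open>S\<close>
  (\<open>totally_real_complements\<close>).  Conversely, if \<open>J T\<close> is such a complement for some \<open>S\<close>, then a
  vector of \<open>T\<close> that is \<open>g\<close>-orthogonal to \<open>T\<close> is \<open>h\<close>-orthogonal to \<open>T + J T\<close>, hence lies in the
  double orthogonal space \<open>S\<close>, which meets \<open>T\<close> in \<open>0\<close> only (\<open>nondegenerate_if_complements\<close>).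

  The two bundles must also be smooth.  For \<open>J T\<close> a smooth frame of \<open>T\<close> is moved by \<open>J\<close>.  The
  bundle \<open>S\<close> is locally the common kernel of the \<open>2 m\<close> forms that pair with a frame of \<open>T \<oplus> J T\<close>, which
  are smooth and linearly independent.  A smooth frame of such a kernel is found by Gaussian
  elimination, one form at a time (\<open>kernel_frame\<close>); the only division is by a pivot that is
  non-zero near the given point.

  Fields are handled through their components in one fixed pair of charts of \<open>M\<close> and of the ambient
  manifold (\<open>smooth_alongI\<close>); the tensors \<open>J\<close> and \<open>g\<close>, whose smoothness is known on ambient fields
  only, act along \<open>M\<close> through their values on coordinate fields (\<open>tensor_1_1_along\<close>,
  \<open>tensor_0_2_along\<close>).  The two parts of the theorem then follow from the equivalence
  \<open>totally_real_iff\<close> by comparing \<open>m\<close> with the codimension.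
\<close>

section \<open>Calculus of smooth maps\<close>

lemma Ck_on_subset: "Ck_on k S f \<Longrightarrow> T \<subseteq> S \<Longrightarrow> Ck_on k T f"
  by (induction k arbitrary: f) (auto intro: continuous_on_subset)

text \<open>
  A derivative at a point of an open set depends only on the values of the map on that set.
\<close>

lemma Ck_on_cong:
  assumes "open S" "\<And>x. x \<in> S \<Longrightarrow> f x = g x" "Ck_on k S f"
  shows "Ck_on k S g"
  using assms(2,3)
proof (induction k arbitrary: f g)
  case 0
  then show ?case by (metis Ck_on.simps(1) continuous_on_cong)
next
  case (Suc k)
  have D: "(g has_derivative frechet_derivative f (at x)) (at x)" if "x \<in> S" for x
    using has_derivative_transform_within_open[OF _ assms(1) that] Suc.prems that
    by (fastforce simp: frechet_derivative_works)
  then have eq: "frechet_derivative g (at x) = frechet_derivative f (at x)" if "x \<in> S" for x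
    using frechet_derivative_at that by metis
  have "Ck_on k S (\<lambda>x. frechet_derivative g (at x) v)" for v
    by (rule Suc.IH[of "\<lambda>x. frechet_derivative f (at x) v"]) (use Suc.prems(2) in \<open>simp_all add: eq\<close>)
  with D show ?case by (auto simp: differentiable_def)
qed

text \<open>
  Regularity is proved from an explicit candidate for the derivative.
\<close>

lemma Ck_on_SucI:
  assumes "open S" "\<And>x. x \<in> S \<Longrightarrow> (f has_derivative F x) (at x)"
    "\<And>v. Ck_on k S (\<lambda>x. F x v)"
  shows "Ck_on (Suc k) S f"
proof -
  have "frechet_derivative f (at x) = F x" if "x \<in> S" for x
    using frechet_derivative_at[OF assms(2)[OF that]] by simp
  then have "Ck_on k S (\<lambda>x. frechet_derivative f (at x) v)" for v
    by (intro Ck_on_cong[OF assms(1) _ assms(3)[of v]]) auto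
  with assms(2) show ?thesis by (auto simp: differentiable_def)
qed

lemma Ck_on_Suc_derivative:
  "Ck_on (Suc k) S f \<Longrightarrow> x \<in> S \<Longrightarrow> (f has_derivative frechet_derivative f (at x)) (at x)"
  by (simp add: frechet_derivative_works)

lemma Ck_on_Suc_imp: "Ck_on (Suc k) S f \<Longrightarrow> Ck_on k S f"
proof (induction k arbitrary: f)
  case 0
  then show ?case
    by (auto intro!: continuous_at_imp_continuous_on differentiable_imp_continuous_within)
next
  case (Suc k)
  then show ?case by (metis Ck_on.simps(2))
qed

lemma Ck_on_const: "open S \<Longrightarrow> Ck_on k S (\<lambda>x. a)"
  by (induction k arbitrary: a) (auto intro: Ck_on_SucI[where F = "\<lambda>x v. 0"])

lemma Ck_on_bounded_linear:
  assumes "open S" "bounded_linear L" "Ck_on k S f"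
  shows "Ck_on k S (\<lambda>x. L (f x))"
  using assms(3)
proof (induction k arbitrary: f)
  case 0
  then show ?case using assms(2) by (auto intro: bounded_linear.continuous_on)
next
  case (Suc k)
  show ?case
    by (rule Ck_on_SucI[where F = "\<lambda>x v. L (frechet_derivative f (at x) v)"])
      (use assms(1) Suc.prems in
        \<open>auto intro!: bounded_linear.has_derivative[OF assms(2)] Suc.IH Ck_on_Suc_derivative\<close>)
qed

lemma Ck_on_add:
  assumes "open S" "Ck_on k S f" "Ck_on k S g"
  shows "Ck_on k S (\<lambda>x. f x + g x)"
  using assms(2,3)
proof (induction k arbitrary: f g)
  case 0
  then show ?case by (auto intro: continuous_intros)
next
  case (Suc k)
  show ?case
    by (rule Ck_on_SucI[where F = "\<lambda>x v. frechet_derivative f (at x) v + frechet_derivative g (at x) v"])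
      (use assms(1) Suc.prems in \<open>auto intro!: has_derivative_add Suc.IH Ck_on_Suc_derivative\<close>)
qed

lemma Ck_on_sum:
  assumes "open S" "\<And>i. i \<in> I \<Longrightarrow> Ck_on k S (f i)"
  shows "Ck_on k S (\<lambda>x. \<Sum>i\<in>I. f i x)"
  using assms(2)
  by (induction I rule: infinite_finite_induct) (auto intro: Ck_on_const Ck_on_add assms(1))

lemma Ck_on_bilinear:
  assumes "open S" "bounded_bilinear p" "Ck_on k S f" "Ck_on k S g"
  shows "Ck_on k S (\<lambda>x. p (f x) (g x))"
  using assms(3,4)
proof (induction k arbitrary: f g)
  case 0
  then show ?case using assms(2) by (auto intro: bounded_bilinear.continuous_on)
next
  case (Suc k)
  show ?case
  proof (rule Ck_on_SucI[OF assms(1)])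
    show "((\<lambda>x. p (f x) (g x)) has_derivative
        (\<lambda>v. p (f x) (frechet_derivative g (at x) v) + p (frechet_derivative f (at x) v) (g x))) (at x)"
      if "x \<in> S" for x
      using Suc.prems that by (intro bounded_bilinear.FDERIV[OF assms(2)] Ck_on_Suc_derivative)
    show "Ck_on k S (\<lambda>x. p (f x) (frechet_derivative g (at x) v) + p (frechet_derivative f (at x) v) (g x))"
      for v
      using Suc.prems Suc.prems[THEN Ck_on_Suc_imp] by (intro Ck_on_add assms(1) Suc.IH) auto
  qed
qed

lemmas Ck_on_scaleR = Ck_on_bilinear[OF _ bounded_bilinear_scaleR]
lemmas Ck_on_inner = Ck_on_bilinear[OF _ bounded_bilinear_inner]
lemmas Ck_on_mult = Ck_on_bilinear[OF _ bounded_bilinear_mult]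

text \<open>
  The derivative of the reciprocal is a polynomial in the reciprocal and in the derivative of
  \<open>f\<close>, so the reciprocal gains orders of regularity one at a time.
\<close>

lemma Ck_on_inverse:
  fixes f :: "'e::euclidean_space \<Rightarrow> real"
  assumes "open S" "Ck_on k S f" "\<And>x. x \<in> S \<Longrightarrow> f x \<noteq> 0"
  shows "Ck_on k S (\<lambda>x. inverse (f x))"
  using assms(2)
proof (induction k)
  case 0
  then show ?case using assms(3) by (auto intro: continuous_intros)
next
  case (Suc k)
  then have IH: "Ck_on k S (\<lambda>x. inverse (f x))" using Ck_on_Suc_imp by blast
  show ?case
  proof (rule Ck_on_SucI[OF assms(1)])
    show "((\<lambda>x. inverse (f x)) has_derivative
        (\<lambda>v. - (inverse (f x) * frechet_derivative f (at x) v * inverse (f x)))) (at x)"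
      if "x \<in> S" for x
      using Suc.prems that assms(3) by (intro Deriv.has_derivative_inverse Ck_on_Suc_derivative)
    show "Ck_on k S (\<lambda>x. - (inverse (f x) * frechet_derivative f (at x) v * inverse (f x)))" for v
      using Suc.prems IH
      by (intro Ck_on_bounded_linear[OF assms(1) bounded_linear_minus[OF bounded_linear_ident]]
          Ck_on_mult assms(1)) auto
  qed
qed

lemma Ck_on_compose:
  assumes "open S" "Ck_on k T g" "Ck_on k S f" "f ` S \<subseteq> T"
  shows "Ck_on k S (\<lambda>x. g (f x))"
  using assms(2,3)
proof (induction k arbitrary: g)
  case 0
  then show ?case using assms(4) by (auto intro: continuous_on_compose2)
next
  case (Suc k)
  have f: "Ck_on k S f" using Suc.prems Ck_on_Suc_imp by blast
  let ?G = "\<lambda>x. frechet_derivative g (at x)" and ?F = "\<lambda>x. frechet_derivative f (at x)"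
  show ?case
  proof (rule Ck_on_SucI[OF assms(1)])
    fix x assume x: "x \<in> S"
    have "f x \<in> T" using x assms(4) by blast
    then have g': "(g has_derivative ?G (f x)) (at (f x))"
      by (rule Ck_on_Suc_derivative[OF Suc.prems(1)])
    have f': "(f has_derivative ?F x) (at x)"
      using x by (rule Ck_on_Suc_derivative[OF Suc.prems(2)])
    \<comment> \<open>Expanding the inner derivative in the standard basis leaves only derivatives of \<open>g\<close> in
      fixed directions, to which the induction hypothesis applies.\<close>
    have "?G (f x) w = (\<Sum>b\<in>Basis. (w \<bullet> b) *\<^sub>R ?G (f x) b)" for w
    proof -
      interpret linear "?G (f x)" using g' has_derivative_linear by blast
      have "?G (f x) w = ?G (f x) (\<Sum>b\<in>Basis. (w \<bullet> b) *\<^sub>R b)" by (simp add: euclidean_representation)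
      then show ?thesis by (simp add: sum scale)
    qed
    then have "(\<lambda>v. ?G (f x) (?F x v)) = (\<lambda>v. \<Sum>b\<in>Basis. (?F x v \<bullet> b) *\<^sub>R ?G (f x) b)"
      by (rule ext)
    with has_derivative_compose[OF f' g'] show "((\<lambda>x. g (f x)) has_derivative
        (\<lambda>v. \<Sum>b\<in>Basis. (?F x v \<bullet> b) *\<^sub>R ?G (f x) b)) (at x)"
      by (rule back_subst)
  next
    show "Ck_on k S (\<lambda>x. \<Sum>b\<in>Basis. (?F x v \<bullet> b) *\<^sub>R ?G (f x) b)" for v
      using Suc.prems f by (intro Ck_on_sum Ck_on_scaleR Ck_on_inner Ck_on_const Suc.IH assms(1)) auto
  qed
qed

lemma smooth_on_subset: "smooth_on S f \<Longrightarrow> T \<subseteq> S \<Longrightarrow> smooth_on T f"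
  unfolding smooth_on_def using Ck_on_subset by blast

lemma smooth_on_cong:
  "open S \<Longrightarrow> (\<And>x. x \<in> S \<Longrightarrow> f x = g x) \<Longrightarrow> smooth_on S f \<Longrightarrow> smooth_on S g"
  unfolding smooth_on_def using Ck_on_cong by blast

lemma smooth_on_const: "open S \<Longrightarrow> smooth_on S (\<lambda>x. a)"
  unfolding smooth_on_def by (simp add: Ck_on_const)

lemma smooth_on_diff:
  "open S \<Longrightarrow> smooth_on S f \<Longrightarrow> smooth_on S g \<Longrightarrow> smooth_on S (\<lambda>x. f x - g x)"
  using Ck_on_add[of S _ f "\<lambda>x. - g x"]
    Ck_on_bounded_linear[OF _ bounded_linear_minus[OF bounded_linear_ident], of S _ g]
  unfolding smooth_on_def by simp

lemma smooth_on_sum: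
  "open S \<Longrightarrow> (\<And>i. i \<in> I \<Longrightarrow> smooth_on S (f i)) \<Longrightarrow> smooth_on S (\<lambda>x. \<Sum>i\<in>I. f i x)"
  unfolding smooth_on_def by (simp add: Ck_on_sum)

lemma smooth_on_scaleR:
  "open S \<Longrightarrow> smooth_on S f \<Longrightarrow> smooth_on S g \<Longrightarrow> smooth_on S (\<lambda>x. f x *\<^sub>R g x)"
  unfolding smooth_on_def by (simp add: Ck_on_scaleR)

lemma smooth_on_inner:
  "open S \<Longrightarrow> smooth_on S f \<Longrightarrow> smooth_on S g \<Longrightarrow> smooth_on S (\<lambda>x. f x \<bullet> g x)"
  unfolding smooth_on_def by (simp add: Ck_on_inner)

lemma smooth_on_mult:
  fixes f g :: "'e::euclidean_space \<Rightarrow> real"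
  shows "open S \<Longrightarrow> smooth_on S f \<Longrightarrow> smooth_on S g \<Longrightarrow> smooth_on S (\<lambda>x. f x * g x)"
  unfolding smooth_on_def by (simp add: Ck_on_mult)

lemma smooth_on_divide:
  fixes f g :: "'e::euclidean_space \<Rightarrow> real"
  assumes "open S" "smooth_on S f" "smooth_on S g" "\<And>x. x \<in> S \<Longrightarrow> g x \<noteq> 0"
  shows "smooth_on S (\<lambda>x. f x / g x)"
  using assms unfolding smooth_on_def divide_inverse by (simp add: Ck_on_mult Ck_on_inverse)

lemma smooth_on_compose:
  "open S \<Longrightarrow> smooth_on T g \<Longrightarrow> smooth_on S f \<Longrightarrow> f ` S \<subseteq> T \<Longrightarrow> smooth_on S (\<lambda>x. g (f x))"
  unfolding smooth_on_def using Ck_on_compose by blast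

lemma smooth_on_derivative:
  "smooth_on S f \<Longrightarrow> smooth_on S (\<lambda>x. frechet_derivative f (at x) v)"
  unfolding smooth_on_def by (metis Ck_on.simps(2))

lemma smooth_on_has_derivative:
  "smooth_on S f \<Longrightarrow> x \<in> S \<Longrightarrow> (f has_derivative frechet_derivative f (at x)) (at x)"
  unfolding smooth_on_def using Ck_on_Suc_derivative by blast

lemma smooth_on_continuous: "smooth_on S f \<Longrightarrow> continuous_on S f"
  unfolding smooth_on_def by (metis Ck_on.simps(1))


section \<open>Frames and kernels of smooth families of forms\<close>

text \<open>
  The index set is an arbitrary finite set, so that a member can be discarded without
  renumbering the others.
\<close>

definition frame :: "'i set \<Rightarrow> ('i \<Rightarrow> 'v::real_vector) \<Rightarrow> 'v set \<Rightarrow> bool" where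
  "frame I B E \<longleftrightarrow> finite I \<and> (\<forall>a. (\<Sum>i\<in>I. a i *\<^sub>R B i) = 0 \<longrightarrow> (\<forall>i\<in>I. a i = 0)) \<and>
     range (\<lambda>a. \<Sum>i\<in>I. a i *\<^sub>R B i) = E"

lemma frame_coeff_zero: "frame I B E \<Longrightarrow> (\<Sum>i\<in>I. a i *\<^sub>R B i) = 0 \<Longrightarrow> i \<in> I \<Longrightarrow> a i = 0"
  by (simp add: frame_def)

lemma frame_Basis: "frame Basis (\<lambda>b. b) (UNIV :: 'e::euclidean_space set)"
proof -
  have "a b = 0" if "(\<Sum>b\<in>Basis. a b *\<^sub>R b) = (0::'e)" "b \<in> Basis" for a and b :: 'e
    using that by (metis inner_sum_left_Basis inner_zero_left)
  moreover have "v \<in> range (\<lambda>a. \<Sum>b\<in>Basis. a b *\<^sub>R b)" for v :: 'e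
    by (rule image_eqI[where x = "\<lambda>b. v \<bullet> b"]) (simp_all add: euclidean_representation)
  ultimately show ?thesis by (auto simp: frame_def)
qed

lemma frame_linear_image:
  assumes "frame I B E" "linear f" "inj f"
  shows "frame I (\<lambda>i. f (B i)) (f ` E)"
proof -
  interpret linear f by fact
  have eq: "(\<Sum>i\<in>I. a i *\<^sub>R f (B i)) = f (\<Sum>i\<in>I. a i *\<^sub>R B i)" for a by (simp add: sum scale)
  have "f x = 0 \<longleftrightarrow> x = 0" for x using assms(3) by (metis injD zero)
  then show ?thesis using assms(1) by (auto simp: frame_def eq image_image)
qed

lemma frame_reindex:
  assumes "frame I B E" "bij_betw \<sigma> K I"
  shows "frame K (\<lambda>k. B (\<sigma> k)) E"
proof -
  have eq: "(\<Sum>k\<in>K. a (\<sigma> k) *\<^sub>R B (\<sigma> k)) = (\<Sum>i\<in>I. a i *\<^sub>R B i)" for a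
    using sum.reindex_bij_betw[OF assms(2), of "\<lambda>i. a i *\<^sub>R B i"] .
  define \<tau> where "\<tau> = the_inv_into K \<sigma>"
  have \<tau>: "\<tau> (\<sigma> k) = k" if "k \<in> K" for k
    using that assms(2) by (simp add: \<tau>_def bij_betw_def the_inv_into_f_f)
  have eq': "(\<Sum>k\<in>K. a k *\<^sub>R B (\<sigma> k)) = (\<Sum>i\<in>I. a (\<tau> i) *\<^sub>R B i)" for a
    unfolding eq[symmetric] by (rule sum.cong) (simp_all add: \<tau>)
  have "finite K" using assms bij_betw_finite by (auto simp: frame_def)
  moreover have "a k = 0" if "(\<Sum>k\<in>K. a k *\<^sub>R B (\<sigma> k)) = 0" "k \<in> K" for a k
  proof -
    have "\<sigma> k \<in> I" using assms(2) that(2) bij_betwE by blast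
    then have "a (\<tau> (\<sigma> k)) = 0"
      using frame_coeff_zero[OF assms(1), of "\<lambda>i. a (\<tau> i)"] that(1) by (simp add: eq')
    then show ?thesis using \<tau>[OF that(2)] by simp
  qed
  moreover have "range (\<lambda>a. \<Sum>k\<in>K. a k *\<^sub>R B (\<sigma> k)) = E"
  proof -
    have "range (\<lambda>a. \<Sum>k\<in>K. a k *\<^sub>R B (\<sigma> k)) = range (\<lambda>a. \<Sum>i\<in>I. a i *\<^sub>R B i)"
    proof (intro equalityI image_subsetI)
      show "(\<Sum>k\<in>K. a k *\<^sub>R B (\<sigma> k)) \<in> range (\<lambda>a. \<Sum>i\<in>I. a i *\<^sub>R B i)" for a
        unfolding eq' by (rule rangeI)
      show "(\<Sum>i\<in>I. a i *\<^sub>R B i) \<in> range (\<lambda>a. \<Sum>k\<in>K. a k *\<^sub>R B (\<sigma> k))" for a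
        unfolding eq[symmetric] by (rule rangeI)
    qed
    then show ?thesis using assms(1) by (simp add: frame_def)
  qed
  ultimately show ?thesis by (auto simp: frame_def)
qed

lemma frame_imp_basis:
  fixes B :: "'i \<Rightarrow> 'e::euclidean_space"
  assumes "frame I B E"
  shows "inj_on B I" "independent (B ` I)" "span (B ` I) = E"
proof -
  have fin: "finite I" and zero: "\<And>a. (\<Sum>i\<in>I. a i *\<^sub>R B i) = 0 \<Longrightarrow> \<forall>i\<in>I. a i = 0"
    and E: "range (\<lambda>a. \<Sum>i\<in>I. a i *\<^sub>R B i) = E"
    using assms by (auto simp: frame_def)
  show inj: "inj_on B I"
  proof (rule inj_onI, rule ccontr)
    fix i j assume ij: "i \<in> I" "j \<in> I" "B i = B j" "i \<noteq> j"
    have "(\<Sum>l\<in>I. (if l = i then 1 else if l = j then -1 else 0) *\<^sub>R B l)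
        = (\<Sum>l\<in>{i, j}. (if l = i then 1 else if l = j then -1 else 0) *\<^sub>R B l)"
      using ij fin by (intro sum.mono_neutral_right) auto
    also have "\<dots> = 0" using ij by simp
    finally show False using zero ij(1) by fastforce
  qed
  have sum_image: "(\<Sum>v\<in>B ` I. c v *\<^sub>R v) = (\<Sum>i\<in>I. c (B i) *\<^sub>R B i)" for c
    using inj by (simp add: sum.reindex)
  show "independent (B ` I)"
    unfolding independent_explicit
  proof (intro conjI allI impI)
    fix c assume "(\<Sum>v\<in>B ` I. c v *\<^sub>R v) = 0"
    then show "\<forall>v\<in>B ` I. c v = 0" using zero[of "\<lambda>i. c (B i)"] by (simp add: sum_image)
  qed (use fin in simp)
  have "(\<Sum>i\<in>I. a i *\<^sub>R B i) \<in> span (B ` I)" for a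
    by (intro span_sum span_scale span_base imageI)
  moreover have "v \<in> E" if "v \<in> span (B ` I)" for v
    using that fin by (auto simp: span_finite sum_image simp flip: E)
  ultimately show "span (B ` I) = E" using E by blast
qed

text \<open>
  One step of Gaussian elimination: a frame vector on which \<open>l\<close> does not vanish is discarded, and
  the multiple of it that makes \<open>l\<close> vanish is subtracted from each of the others.
\<close>

lemma frame_pivot:
  assumes "frame I B E" "p \<in> I" "linear l" and nz: "l (B p) \<noteq> (0::real)"
  shows "frame (I - {p}) (\<lambda>i. B i - (l (B i) / l (B p)) *\<^sub>R B p) {v \<in> E. l v = 0}"
proof -
  interpret linear l by fact
  have fin: "finite I" and zero: "\<And>a. (\<Sum>i\<in>I. a i *\<^sub>R B i) = 0 \<Longrightarrow> \<forall>i\<in>I. a i = 0"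
    and E: "range (\<lambda>a. \<Sum>i\<in>I. a i *\<^sub>R B i) = E"
    using assms by (auto simp: frame_def)
  define c where "c i = l (B i) / l (B p)" for i
  define s where "s a = - (\<Sum>i\<in>I - {p}. a i * c i)" for a
  have eq: "(\<Sum>i\<in>I - {p}. a i *\<^sub>R (B i - c i *\<^sub>R B p)) = (\<Sum>i\<in>I. (a(p := s a)) i *\<^sub>R B i)" for a
  proof -
    have "(\<Sum>i\<in>I - {p}. a i *\<^sub>R (B i - c i *\<^sub>R B p)) = (\<Sum>i\<in>I - {p}. a i *\<^sub>R B i) + s a *\<^sub>R B p"
      by (simp add: s_def scaleR_diff_right sum_subtractf scaleR_sum_left)
    also have "(\<Sum>i\<in>I - {p}. a i *\<^sub>R B i) = (\<Sum>i\<in>I - {p}. (a(p := s a)) i *\<^sub>R B i)"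
      by (rule sum.cong) auto
    finally show ?thesis by (simp add: sum.remove[OF fin \<open>p \<in> I\<close>] add.commute)
  qed
  have "a i = 0" if "(\<Sum>i\<in>I - {p}. a i *\<^sub>R (B i - c i *\<^sub>R B p)) = 0" "i \<in> I - {p}" for a i
    using zero[of "a(p := s a)"] that unfolding eq by (metis DiffE fun_upd_other insertI1)
  moreover have "(\<Sum>i\<in>I - {p}. a i *\<^sub>R (B i - c i *\<^sub>R B p)) \<in> {v \<in> E. l v = 0}" for a
  proof -
    have "l (\<Sum>i\<in>I - {p}. a i *\<^sub>R (B i - c i *\<^sub>R B p)) = 0"
      using nz by (simp add: sum scale diff c_def)
    moreover have "(\<Sum>i\<in>I - {p}. a i *\<^sub>R (B i - c i *\<^sub>R B p)) \<in> E"
      unfolding eq E[symmetric] by (rule rangeI)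
    ultimately show ?thesis by blast
  qed
  moreover have "v \<in> range (\<lambda>a. \<Sum>i\<in>I - {p}. a i *\<^sub>R (B i - c i *\<^sub>R B p))"
    if "v \<in> E" "l v = 0" for v
  proof -
    obtain a where a: "v = (\<Sum>i\<in>I. a i *\<^sub>R B i)" using E \<open>v \<in> E\<close> by blast
    then have "0 = a p * l (B p) + (\<Sum>i\<in>I - {p}. a i * l (B i))"
      using \<open>l v = 0\<close> by (simp add: add sum scale sum.remove[OF fin \<open>p \<in> I\<close>])
    then have "a p = s a"
      using nz by (simp add: s_def c_def field_simps flip: sum_divide_distrib)
    then have "a(p := s a) = a" by (metis fun_upd_triv)
    then have "v = (\<Sum>i\<in>I - {p}. a i *\<^sub>R (B i - c i *\<^sub>R B p))" unfolding eq a by simp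
    then show ?thesis by blast
  qed
  ultimately show ?thesis
    using fin unfolding frame_def c_def[symmetric] by blast
qed

text \<open>
  The common kernel of \<open>K\<close> forms (represented by vectors through the inner product) that are
  independent at a single point has a smooth frame near that point.  The proof starts from the
  standard basis and performs one elimination step for each form; the neighbourhood shrinks to the
  set where the pivot is non-zero, and independence at \<open>y0\<close> guarantees that a pivot exists.
\<close>

lemma kernel_frame:
  fixes \<alpha> :: "'j \<Rightarrow> 'f::euclidean_space \<Rightarrow> 'e::euclidean_space"
  assumes "finite K" "open \<Omega>" "y0 \<in> \<Omega>" "\<And>j. j \<in> K \<Longrightarrow> smooth_on \<Omega> (\<alpha> j)"
    and "\<And>a. (\<Sum>j\<in>K. a j *\<^sub>R \<alpha> j y0) = 0 \<Longrightarrow> \<forall>j\<in>K. a j = 0"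
  shows "\<exists>\<Omega>' (I :: 'e set) B. open \<Omega>' \<and> y0 \<in> \<Omega>' \<and> \<Omega>' \<subseteq> \<Omega> \<and> card I + card K = DIM('e) \<and>
     (\<forall>i\<in>I. smooth_on \<Omega>' (B i)) \<and> (\<forall>y\<in>\<Omega>'. frame I (\<lambda>i. B i y) {v. \<forall>j\<in>K. \<alpha> j y \<bullet> v = 0})"
  using assms(1,4,5)
proof (induction K rule: finite_induct)
  case empty
  then show ?case
    using assms(2,3) frame_Basis
    by (intro exI[of _ \<Omega>] exI[of _ Basis] exI[of _ "\<lambda>i y. i"]) (auto intro: smooth_on_const)
next
  case (insert q K)
  have "\<forall>j\<in>K. a j = 0" if "(\<Sum>j\<in>K. a j *\<^sub>R \<alpha> j y0) = 0" for a
  proof -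
    have "(\<Sum>j\<in>K. (a(q := 0)) j *\<^sub>R \<alpha> j y0) = (\<Sum>j\<in>K. a j *\<^sub>R \<alpha> j y0)"
      using insert.hyps by (intro sum.cong) auto
    then have "(\<Sum>j\<in>insert q K. (a(q := 0)) j *\<^sub>R \<alpha> j y0) = 0"
      using insert.hyps that by simp
    from insert.prems(2)[OF this] show ?thesis using insert.hyps by (metis fun_upd_other insertCI)
  qed
  then obtain \<Omega>' and I :: "'e set" and B where
    \<Omega>': "open \<Omega>'" "y0 \<in> \<Omega>'" "\<Omega>' \<subseteq> \<Omega>" and card: "card I + card K = DIM('e)"
    and smooth: "\<And>i. i \<in> I \<Longrightarrow> smooth_on \<Omega>' (B i)"
    and frame: "\<And>y. y \<in> \<Omega>' \<Longrightarrow> frame I (\<lambda>i. B i y) {v. \<forall>j\<in>K. \<alpha> j y \<bullet> v = 0}"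
    using insert.IH insert.prems(1) by (smt (verit) insertCI)
  \<comment> \<open>The form \<open>\<alpha> q\<close> is not a combination of the others at \<open>y0\<close>, so it does not vanish on their
    common kernel.\<close>
  have "\<exists>p\<in>I. \<alpha> q y0 \<bullet> B p y0 \<noteq> 0"
  proof (rule ccontr)
    assume "\<not> ?thesis"
    then have q_zero: "\<alpha> q y0 \<bullet> B p y0 = 0" if "p \<in> I" for p using that by blast
    let ?W = "range (\<lambda>a. \<Sum>j\<in>K. a j *\<^sub>R \<alpha> j y0)"
    have "subspace ?W"
      unfolding subspace_def
    proof (intro conjI ballI allI)
      show "0 \<in> ?W" by (rule image_eqI[where x = "\<lambda>j. 0"]) simp_all
      fix v assume "v \<in> ?W"
      then obtain a where a: "v = (\<Sum>j\<in>K. a j *\<^sub>R \<alpha> j y0)" by blast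
      show "c *\<^sub>R v \<in> ?W" for c
        by (rule image_eqI[where x = "\<lambda>j. c * a j"]) (simp_all add: a scaleR_sum_right)
      fix w assume "w \<in> ?W"
      then obtain b where b: "w = (\<Sum>j\<in>K. b j *\<^sub>R \<alpha> j y0)" by blast
      show "v + w \<in> ?W"
        by (rule image_eqI[where x = "\<lambda>j. a j + b j"])
          (simp_all add: a b scaleR_add_left sum.distrib)
    qed
    moreover have "\<alpha> q y0 \<in> ?W\<^sup>\<bottom>\<^sup>\<bottom>"
    proof -
      have "v \<bullet> \<alpha> q y0 = 0" if v: "v \<in> ?W\<^sup>\<bottom>" for v
      proof -
        have "\<alpha> j y0 \<in> ?W" if "j \<in> K" for j
          using that insert.hyps(1)
          by (intro image_eqI[where x = "\<lambda>i. if i = j then 1 else 0"])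
            (simp_all add: if_distrib[of "\<lambda>a. a *\<^sub>R _"] cong: if_cong)
        then have "v \<in> {v. \<forall>j\<in>K. \<alpha> j y0 \<bullet> v = 0}"
          using v unfolding orthogonal_comp_def orthogonal_def by blast
        then obtain a where "v = (\<Sum>i\<in>I. a i *\<^sub>R B i y0)"
          using frame[OF \<Omega>'(2)] unfolding frame_def by blast
        then show ?thesis by (simp add: inner_sum_right q_zero inner_commute[of _ "\<alpha> q y0"])
      qed
      then show ?thesis by (auto simp: orthogonal_comp_def[of "?W\<^sup>\<bottom>"] orthogonal_def)
    qed
    ultimately have "\<alpha> q y0 \<in> ?W" using orthogonal_comp_self by metis
    then obtain a where a: "\<alpha> q y0 = (\<Sum>j\<in>K. a j *\<^sub>R \<alpha> j y0)" by blast
    have "(\<Sum>j\<in>K. (a(q := -1)) j *\<^sub>R \<alpha> j y0) = (\<Sum>j\<in>K. a j *\<^sub>R \<alpha> j y0)"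
      using insert.hyps by (intro sum.cong) auto
    then have "(\<Sum>j\<in>insert q K. (a(q := -1)) j *\<^sub>R \<alpha> j y0) = 0"
      using insert.hyps a by simp
    from insert.prems(2)[OF this] show False by auto
  qed
  then obtain p where p: "p \<in> I" "\<alpha> q y0 \<bullet> B p y0 \<noteq> 0" by blast
  define \<Omega>'' where "\<Omega>'' = {y \<in> \<Omega>'. \<alpha> q y \<bullet> B p y \<noteq> 0}"
  define C where "C i y = B i y - ((\<alpha> q y \<bullet> B i y) / (\<alpha> q y \<bullet> B p y)) *\<^sub>R B p y" for i y
  have smooth_inner: "smooth_on \<Omega>' (\<lambda>y. \<alpha> q y \<bullet> B i y)" if "i \<in> I" for i
    using that smooth insert.prems(1) \<Omega>' by (auto intro: smooth_on_inner smooth_on_subset)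
  have "\<Omega>'' = \<Omega>' \<inter> (\<lambda>y. \<alpha> q y \<bullet> B p y) -` (- {0})" by (auto simp: \<Omega>''_def)
  then have op: "open \<Omega>''"
    using continuous_open_preimage[OF smooth_on_continuous[OF smooth_inner[OF p(1)]] \<Omega>'(1), of "- {0}"]
    by auto
  have sub: "\<Omega>'' \<subseteq> \<Omega>'" by (auto simp: \<Omega>''_def)
  have "smooth_on \<Omega>'' (C i)" if "i \<in> I" for i
    unfolding C_def using that p(1) op
    by (intro smooth_on_diff smooth_on_scaleR smooth_on_divide smooth_on_subset[OF smooth sub]
        smooth_on_subset[OF smooth_inner sub]) (auto simp: \<Omega>''_def)
  moreover have "frame (I - {p}) (\<lambda>i. C i y) {v. \<forall>j\<in>insert q K. \<alpha> j y \<bullet> v = 0}" if "y \<in> \<Omega>''" for y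
  proof -
    have "frame (I - {p}) (\<lambda>i. C i y) {v \<in> {v. \<forall>j\<in>K. \<alpha> j y \<bullet> v = 0}. \<alpha> q y \<bullet> v = 0}"
      unfolding C_def using that p(1)
      by (intro frame_pivot[where l = "\<lambda>v. \<alpha> q y \<bullet> v", OF frame])
        (auto simp: \<Omega>''_def intro: bounded_linear.linear bounded_linear_inner_right)
    also have "{v \<in> {v. \<forall>j\<in>K. \<alpha> j y \<bullet> v = 0}. \<alpha> q y \<bullet> v = 0} = {v. \<forall>j\<in>insert q K. \<alpha> j y \<bullet> v = 0}"
      by auto
    finally show ?thesis .
  qed
  moreover have "card (I - {p}) + card (insert q K) = DIM('e)"
  proof -
    have "finite I" using frame[OF \<Omega>'(2)] by (simp add: frame_def)
    then have "Suc (card (I - {p})) = card I" using p(1) by (rule card_Suc_Diff1)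
    then show ?thesis using card insert.hyps by simp
  qed
  moreover have "y0 \<in> \<Omega>''" using \<Omega>' p by (simp add: \<Omega>''_def)
  ultimately show ?case
    using op sub \<Omega>'(3) by (intro exI[of _ \<Omega>''] exI[of _ "I - {p}"] exI[of _ C]) auto
qed


section \<open>Linear algebra of a tangent space with Norden metric\<close>

text \<open>
  Writing \<open>b v w\<close> as the inner product of \<open>A v\<close> with \<open>w\<close> turns \<open>b\<close>-orthogonality into Euclidean
  orthogonality, because non-degeneracy makes \<open>A\<close> bijective.
\<close>

lemma double_orth:
  fixes b :: "'e::euclidean_space \<Rightarrow> 'e \<Rightarrow> real"
  assumes "bilinear b" "\<And>v w. b v w = b w v" "nondegenerate_on b UNIV" "subspace W"
  shows "orth b (orth b W) = W"
proof -
  define A where "A v = (\<Sum>i\<in>Basis. b v i *\<^sub>R i)" for v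
  have linear_b: "linear (b v)" for v using assms(1) by (simp add: bilinear_def)
  have b_eq: "b v w = A v \<bullet> w" for v w
  proof -
    have "b v w = b v (\<Sum>i\<in>Basis. (w \<bullet> i) *\<^sub>R i)" by (simp add: euclidean_representation)
    also have "\<dots> = (\<Sum>i\<in>Basis. (w \<bullet> i) * b v i)"
      by (simp add: linear_sum[OF linear_b] linear_cmul[OF linear_b])
    also have "\<dots> = A v \<bullet> w"
      by (simp add: A_def inner_commute[of _ w] inner_sum_right mult.commute)
    finally show ?thesis .
  qed
  have linear_A: "linear A"
    by (rule linearI)
      (simp_all add: A_def bilinear_ladd[OF assms(1)] bilinear_lmul[OF assms(1)] scaleR_sum_right
        sum.distrib scaleR_add_left)
  have "inj A"
    unfolding linear_injective_0[OF linear_A]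
    using assms(3) by (auto simp: nondegenerate_on_def b_eq)
  then have "surj A" using linear_A linear_injective_imp_surjective by blast
  have perp: "orth b V = A -` (V\<^sup>\<bottom>)" for V
    by (auto simp: orth_def b_eq orthogonal_comp_def orthogonal_def inner_commute)
  have "orth b (orth b W) \<subseteq> W"
  proof
    fix v assume "v \<in> orth b (orth b W)"
    then have "b v u = 0" if "A u \<in> W\<^sup>\<bottom>" for u
      using that perp[of W] unfolding orth_def[of b "orth b W"] by blast
    then have "A u \<bullet> v = 0" if "A u \<in> W\<^sup>\<bottom>" for u
      using that assms(2)[of v u] b_eq[of u v] by simp
    then have "z \<bullet> v = 0" if "z \<in> W\<^sup>\<bottom>" for z
      using that \<open>surj A\<close> by (metis surjD)
    then have "v \<in> W\<^sup>\<bottom>\<^sup>\<bottom>" by (simp add: orthogonal_comp_def[of "W\<^sup>\<bottom>"] orthogonal_def)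
    then show "v \<in> W" using orthogonal_comp_self[OF assms(4)] by simp
  qed
  moreover have "W \<subseteq> orth b (orth b W)"
    using assms(2) by (auto simp: orth_def)
  ultimately show ?thesis by blast
qed

lemma orth_antimono: "V \<subseteq> W \<Longrightarrow> orth b W \<subseteq> orth b V"
  by (auto simp: orth_def)

lemma subspace_orth: "bilinear b \<Longrightarrow> subspace (orth b W)"
  by (auto simp: subspace_def orth_def bilinear_lzero bilinear_ladd bilinear_lmul)

text \<open>
  The \<open>b\<close>-orthogonal projection to \<open>W\<close> exists: a vector orthogonal to \<open>W + orth b W\<close> lies in \<open>W\<close>
  and is orthogonal to it, so it is zero, and the double orthogonal space of the sum is everything.
\<close>

lemma nondegenerate_decomposition:
  fixes b :: "'e::euclidean_space \<Rightarrow> 'e \<Rightarrow> real"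
  assumes "bilinear b" "\<And>v w. b v w = b w v" "nondegenerate_on b UNIV"
    and "subspace W" "nondegenerate_on b W"
  shows "\<exists>t\<in>W. \<forall>w\<in>W. b (v - t) w = 0"
proof -
  let ?P = "{t + s | t s. t \<in> W \<and> s \<in> orth b W}"
  have "subspace ?P" using assms(1,4) by (intro subspace_sums subspace_orth)
  moreover have "orth b ?P = {0}"
  proof (intro equalityI subsetI)
    fix u assume u: "u \<in> orth b ?P"
    have "W \<subseteq> ?P" using subspace_0[OF subspace_orth[OF assms(1)]] by force
    moreover have "orth b W \<subseteq> ?P" using subspace_0[OF assms(4)] by force
    ultimately have "u \<in> orth b W" "u \<in> orth b (orth b W)"
      using u orth_antimono by blast+
    then show "u \<in> {0}"
      using assms(5) double_orth[OF assms(1-4)] by (auto simp: nondegenerate_on_def orth_def)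
  qed (auto simp: orth_def bilinear_lzero[OF assms(1)])
  ultimately have "?P = orth b {0}" using double_orth[OF assms(1-3), of ?P] by simp
  then have "v \<in> ?P" by (auto simp: orth_def bilinear_rzero[OF assms(1)])
  then obtain t s where "v = t + s" "t \<in> W" "s \<in> orth b W" by blast
  then show ?thesis by (auto simp: orth_def intro!: bexI[of _ t])
qed

lemma complement_in_imp_subset: "complement_in A B C \<Longrightarrow> B \<subseteq> C"
  unfolding complement_in_def using subspace_0 by fastforce

locale norden_space =
  fixes J :: "'e::euclidean_space \<Rightarrow> 'e" and g :: "'e \<Rightarrow> 'e \<Rightarrow> real"
  assumes linear_J: "linear J" and J_J [simp]: "J (J v) = - v"
    and bilinear_g: "bilinear g" and g_commute: "g v w = g w v"
    and g_nondegenerate: "nondegenerate_on g UNIV"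
    and g_J_J: "g (J v) (J w) = - g v w"
begin

text \<open>
  The associated metric on a single tangent space.
\<close>

definition h :: "'e \<Rightarrow> 'e \<Rightarrow> real" where "h v w = g (J v) w"

lemma h_commute: "h v w = h w v"
  using g_J_J[of v "J w"] bilinear_rneg[OF bilinear_g] g_commute[of "J w" v] by (simp add: h_def)

lemma h_J_right: "h v (J w) = - g v w" and h_J_J: "h (J v) (J w) = - h v w"
  using g_J_J[of v w] g_J_J[of "J v" w] by (simp_all add: h_def)

lemma bilinear_h: "bilinear h"
  using bilinear_g linear_J
  by (auto simp: bilinear_def h_def intro: linear_compose[OF linear_J, unfolded o_def])

lemma h_nondegenerate: "nondegenerate_on h UNIV"
  using g_nondegenerate unfolding nondegenerate_on_def h_def
  by (metis J_J UNIV_I linear_0 linear_J neg_equal_0_iff_equal)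

lemmas h_linear = bilinear_ladd[OF bilinear_h] bilinear_radd[OF bilinear_h]
  bilinear_lsub[OF bilinear_h] bilinear_rsub[OF bilinear_h]
  bilinear_lzero[OF bilinear_h] bilinear_rzero[OF bilinear_h]

lemma subspace_J_image: "subspace T \<Longrightarrow> subspace (J ` T)"
  using linear_J linear_subspace_image by blast

lemma isotropic_iff_J_orth: "T \<subseteq> orth h T \<longleftrightarrow> J ` T \<subseteq> orth g T"
  by (auto simp: orth_def h_def)

lemma isotropic_if_J_orth:
  "J ` T \<subseteq> orth g T \<Longrightarrow> v \<in> T \<Longrightarrow> w \<in> T \<Longrightarrow> h v w = 0"
  by (auto simp: orth_def h_def)

lemma totally_real_Int_J:
  assumes "nondegenerate_on g T" "J ` T \<subseteq> orth g T"
  shows "T \<inter> J ` T \<subseteq> {0}"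
  using assms by (auto simp: nondegenerate_on_def orth_def)

text \<open>
  Subtracting from a vector \<open>h\<close>-orthogonal to \<open>T\<close> its \<open>g\<close>-projection to \<open>T\<close> makes it \<open>h\<close>-orthogonal
  to \<open>J T\<close> too and keeps it orthogonal to \<open>T\<close>, on which \<open>h\<close> vanishes; this gives the first
  complement.  For the second one, \<open>J T + T\<close> is its own double orthogonal space, that is, the
  orthogonal space of \<open>S\<close>.
\<close>

lemma totally_real_complements:
  assumes T: "subspace T" and nd: "nondegenerate_on g T" and perp: "J ` T \<subseteq> orth g T"
  defines "S \<equiv> orth h (T \<union> J ` T)"
  shows "complement_in S T (orth h T)" and "complement_in (J ` T) T (orth h S)"
    and "\<forall>v\<in>J ` T. \<forall>w\<in>J ` T. h v w = 0"
proof -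
  note null = isotropic_if_J_orth[OF perp]
  show null_J: "\<forall>v\<in>J ` T. \<forall>w\<in>J ` T. h v w = 0" by (auto simp: h_J_J null)
  have "\<forall>v. \<exists>t. t \<in> T \<and> (\<forall>w\<in>T. g (v - t) w = 0)"
    using nondegenerate_decomposition[OF bilinear_g g_commute g_nondegenerate T nd] by blast
  then obtain p where p: "p v \<in> T" "\<And>w. w \<in> T \<Longrightarrow> g (v - p v) w = 0" for v
    by metis
  have p_h: "h (v - p v) (J w) = 0" if "w \<in> T" for v w using p(2) that by (simp add: h_J_right)
  have subS: "subspace S" unfolding S_def by (rule subspace_orth[OF bilinear_h])
  show "complement_in S T (orth h T)"
    unfolding complement_in_def
  proof (intro conjI subS equalityI subsetI)
    fix v assume v: "v \<in> S \<inter> T"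
    then have "g v w = 0" if "w \<in> T" for w
      using that h_J_right[of v w] by (force simp: S_def orth_def)
    then show "v \<in> {0}" using nd v by (auto simp: nondegenerate_on_def)
  next
    fix v assume v: "v \<in> orth h T"
    have "h (v - p v) w = 0" if "w \<in> T" for w
      using v null[OF p(1) that] that by (simp add: orth_def h_linear)
    then have "v - p v \<in> S"
      using p_h by (auto simp: S_def orth_def)
    then show "v \<in> {a + b | a b. a \<in> S \<and> b \<in> T}"
      using p(1)[of v] by (metis (mono_tags, lifting) diff_add_cancel mem_Collect_eq)
  qed (use subspace_0[OF subS] subspace_0[OF T] null in \<open>auto simp: S_def orth_def h_linear\<close>)
  let ?P = "{a + b | a b. a \<in> J ` T \<and> b \<in> T}"
  have "S = orth h ?P"
  proof (intro equalityI subsetI)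
    fix v assume "v \<in> orth h ?P"
    then have "h v (a + b) = 0" if "a \<in> J ` T" "b \<in> T" for a b using that by (force simp: orth_def)
    from this[of 0] this[OF _ subspace_0[OF T]] show "v \<in> S"
      using subspace_0[OF subspace_J_image[OF T]] by (auto simp: S_def orth_def)
  qed (auto simp: S_def orth_def h_linear)
  then have "orth h S = ?P"
    using double_orth[OF bilinear_h h_commute h_nondegenerate subspace_sums[OF subspace_J_image[OF T] T]]
    by simp
  moreover have "J ` T \<inter> T = {0}"
    using totally_real_Int_J[OF nd perp] subspace_0[OF T] subspace_0[OF subspace_J_image[OF T]] by blast
  ultimately show "complement_in (J ` T) T (orth h S)"
    using subspace_J_image[OF T] by (simp add: complement_in_def)
qed

text \<open>
  A vector of \<open>T\<close> in the \<open>g\<close>-radical is \<open>h\<close>-orthogonal to \<open>J T\<close> and to \<open>T\<close>, whose sum is the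
  orthogonal space of \<open>S\<close>; so it lies in \<open>S\<close>, which intersects \<open>T\<close> trivially.
\<close>

lemma nondegenerate_if_complements:
  assumes T: "subspace T" and S: "complement_in S T (orth h T)"
    and L: "complement_in (J ` T) T (orth h S)"
  shows "nondegenerate_on g T"
proof -
  have sub_S: "subspace S" using S by (simp add: complement_in_def)
  have T_sub: "T \<subseteq> orth h T" by (rule complement_in_imp_subset[OF S])
  show ?thesis
    unfolding nondegenerate_on_def
  proof (intro ballI impI)
    fix v assume v: "v \<in> T" and perp: "\<forall>w\<in>T. g v w = 0"
    have v_perp: "h v (J a + b) = 0" if "a \<in> T" "b \<in> T" for a b
      using that v T_sub perp by (auto simp: h_linear h_J_right orth_def)
    have "h v w = 0" if "w \<in> orth h S" for w
    proof -
      have "w \<in> {a + b | a b. a \<in> J ` T \<and> b \<in> T}"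
        using that L by (simp only: complement_in_def)
      then obtain a b where "w = J a + b" "a \<in> T" "b \<in> T" by blast
      then show ?thesis using v_perp by simp
    qed
    then have "v \<in> orth h (orth h S)" by (simp add: orth_def[of h "orth h S"])
    then have "v \<in> S"
      using double_orth[OF bilinear_h h_commute h_nondegenerate sub_S] by simp
    with v S show "v = 0" by (auto simp: complement_in_def)
  qed
qed

end


section \<open>Charts and coordinate components\<close>

lemma chart_dom_open: "smooth_manifold M \<Longrightarrow> c \<in> atlas M \<Longrightarrow> openin (mtop M) (chart_dom c)"
  by (simp add: smooth_manifold_def)

lemma chart_homeomorphic:
  "smooth_manifold M \<Longrightarrow> c \<in> atlas M \<Longrightarrow> homeomorphic_map (subtopology (mtop M) (chart_dom c))
     (top_of_set (chart_map c ` chart_dom c)) (chart_map c)"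
  by (simp add: smooth_manifold_def)

lemma topspace_chart_dom:
  "smooth_manifold M \<Longrightarrow> c \<in> atlas M \<Longrightarrow> topspace (subtopology (mtop M) (chart_dom c)) = chart_dom c"
  using chart_dom_open[of M c] openin_subset by fastforce

lemma chart_inv_chart:
  assumes "smooth_manifold M" "c \<in> atlas M" "x \<in> chart_dom c"
  shows "chart_inv c (chart_map c x) = x"
proof -
  have "inj_on (chart_map c) (chart_dom c)"
    using homeomorphic_imp_injective_map[OF chart_homeomorphic[OF assms(1,2)]]
      topspace_chart_dom[OF assms(1,2)] by simp
  then show ?thesis unfolding chart_inv_def using assms(3) by (rule inv_into_f_f)
qed

lemma open_chart_image:
  assumes "smooth_manifold M" "c \<in> atlas M" "openin (mtop M) W" "W \<subseteq> chart_dom c"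
  shows "open (chart_map c ` W)"
proof -
  have "openin (subtopology (mtop M) (chart_dom c)) W"
    using assms by (simp add: openin_open_subtopology chart_dom_open)
  then have "openin (top_of_set (chart_map c ` chart_dom c)) (chart_map c ` W)"
    using homeomorphic_imp_open_map[OF chart_homeomorphic[OF assms(1,2)]] by (simp add: open_map_def)
  moreover have "open (chart_map c ` chart_dom c)" using assms(1,2) by (simp add: smooth_manifold_def)
  ultimately show ?thesis using openin_open_trans by blast
qed

lemma openin_chart_preimage:
  assumes "smooth_manifold M" "c \<in> atlas M" "open \<Omega>"
  shows "openin (mtop M) {x \<in> chart_dom c. chart_map c x \<in> \<Omega>}"
proof -
  have "continuous_map (subtopology (mtop M) (chart_dom c)) euclidean (chart_map c)"
    using homeomorphic_imp_continuous_map[OF chart_homeomorphic[OF assms(1,2)]]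
    by (simp add: continuous_map_in_subtopology)
  then have "openin (subtopology (mtop M) (chart_dom c)) {x \<in> chart_dom c. chart_map c x \<in> \<Omega>}"
    using openin_continuous_map_preimage[of _ euclidean "chart_map c" \<Omega>]
      topspace_chart_dom[OF assms(1,2)] assms(3) by (metis open_openin)
  then show ?thesis using chart_dom_open[OF assms(1,2)] openin_trans_full by blast
qed

lemma chart_at:
  assumes "smooth_manifold M" "x \<in> points M"
  shows "chart_at M x \<in> atlas M" "x \<in> chart_dom (chart_at M x)"
proof -
  have "\<exists>c. c \<in> atlas M \<and> x \<in> chart_dom c" using assms by (auto simp: smooth_manifold_def)
  from someI_ex[OF this] show "chart_at M x \<in> atlas M" "x \<in> chart_dom (chart_at M x)"
    by (simp_all add: chart_at_def)
qed

text \<open>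
  The charts may belong to different manifolds on subsets of the same type: with a chart of a
  submanifold and one of the ambient manifold, this is the differential of the inclusion in
  coordinates.
\<close>

definition transition_derivative ::
    "('a, 'f::euclidean_space) chart \<Rightarrow> ('a, 'e::euclidean_space) chart \<Rightarrow> 'a \<Rightarrow> 'f \<Rightarrow> 'e" where
  "transition_derivative c d x = frechet_derivative (local_rep c id d) (at (chart_map c x))"

lemma components_eq: "components N x d = transition_derivative (chart_at N x) d x"
  by (simp add: fun_eq_iff components_def transition_derivative_def)

lemma differential_id_eq:
  "differential M N id x = transition_derivative (chart_at M x) (chart_at N x) x"
  by (simp add: differential_def transition_derivative_def)

text \<open>
  The hypotheses also hold for \<open>M = N\<close>, so that changes of coordinates and inclusions are treated
  by the same lemmas.
\<close>

locale smooth_inclusion =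
  fixes M :: "('a, 'f::euclidean_space) manifold" and N :: "('a, 'e::euclidean_space) manifold"
  assumes smooth_M: "smooth_manifold M" and smooth_N: "smooth_manifold N"
    and inclusion: "smooth_map M N id"
begin

lemma points_subset: "points M \<subseteq> points N"
  using inclusion by (auto simp: smooth_map_def continuous_map_def)

lemma openin_points_Int: "openin (mtop N) V \<Longrightarrow> openin (mtop M) (points M \<inter> V)"
proof -
  assume "openin (mtop N) V"
  then have "openin (mtop M) {x \<in> points M. id x \<in> V}"
    using inclusion unfolding smooth_map_def by (blast intro: openin_continuous_map_preimage)
  moreover have "{x \<in> points M. id x \<in> V} = points M \<inter> V" by auto
  ultimately show ?thesis by simp
qed

lemma openin_Int_chart_dom:
  assumes "openin (mtop M) U" "d \<in> atlas N"
  shows "openin (mtop M) (U \<inter> chart_dom d)"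
proof -
  have "U \<inter> chart_dom d = U \<inter> (points M \<inter> chart_dom d)" using openin_subset[OF assms(1)] by blast
  then show ?thesis
    using assms(1) openin_points_Int[OF chart_dom_open[OF smooth_N assms(2)]] by (simp add: openin_Int)
qed

lemma smooth_local_rep:
  assumes "c \<in> atlas M" "d \<in> atlas N"
  shows "smooth_on (chart_map c ` (chart_dom c \<inter> chart_dom d)) (local_rep c id d)"
  using inclusion assms by (simp add: smooth_map_def)

lemma local_rep_chart:
  "c \<in> atlas M \<Longrightarrow> x \<in> chart_dom c \<Longrightarrow> local_rep c id d (chart_map c x) = chart_map d x"
  by (simp add: local_rep_def chart_inv_chart[OF smooth_M])

lemma local_rep_has_derivative:
  assumes "c \<in> atlas M" "d \<in> atlas N" "x \<in> chart_dom c" "x \<in> chart_dom d"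
  shows "(local_rep c id d has_derivative transition_derivative c d x) (at (chart_map c x))"
  unfolding transition_derivative_def
  using assms by (intro smooth_on_has_derivative[OF smooth_local_rep]) auto

lemma linear_transition_derivative:
  assumes "c \<in> atlas M" "d \<in> atlas N" "x \<in> chart_dom c" "x \<in> chart_dom d"
  shows "linear (transition_derivative c d x)"
  using local_rep_has_derivative[OF assms] has_derivative_linear by blast

end

lemma smooth_inclusion_refl: "smooth_manifold N \<Longrightarrow> smooth_inclusion N N"
  unfolding smooth_inclusion_def smooth_map_def smooth_manifold_def by simp

text \<open>
  The chain rule for \<open>M \<subseteq> N \<subseteq> P\<close>.  With coinciding manifolds it gives the cocycle rule for changes
  of coordinates.
\<close>

lemma transition_derivative_compose:
  assumes "smooth_inclusion M N" "smooth_inclusion N P"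
    and c: "c \<in> atlas M" "x \<in> chart_dom c" and d: "d \<in> atlas N" "x \<in> chart_dom d"
    and e: "e \<in> atlas P" "x \<in> chart_dom e"
  shows "transition_derivative c e x v = transition_derivative d e x (transition_derivative c d x v)"
proof -
  interpret MN: smooth_inclusion M N by fact
  interpret NP: smooth_inclusion N P by fact
  define W where "W = chart_dom c \<inter> (points M \<inter> (chart_dom d \<inter> chart_dom e))"
  have "openin (mtop M) W"
    unfolding W_def
    by (intro openin_Int MN.openin_points_Int NP.openin_Int_chart_dom chart_dom_open
        MN.smooth_M MN.smooth_N c(1) d(1) e(1))
  then have op: "open (chart_map c ` W)"
    by (rule open_chart_image[OF MN.smooth_M c(1)]) (simp add: W_def)
  have xW: "chart_map c x \<in> chart_map c ` W"
    using c d e openin_subset[OF chart_dom_open[OF MN.smooth_M c(1)]] by (auto simp: W_def)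
  have eq: "local_rep d id e (local_rep c id d y) = local_rep c id e y" if "y \<in> chart_map c ` W" for y
    using that c d chart_inv_chart[OF MN.smooth_M c(1)] chart_inv_chart[OF MN.smooth_N d(1)]
    by (auto simp: W_def local_rep_def)
  have "(local_rep d id e has_derivative transition_derivative d e x)
      (at (local_rep c id d (chart_map c x)))"
    unfolding MN.local_rep_chart[OF c] by (rule NP.local_rep_has_derivative[OF d(1) e(1) d(2) e(2)])
  from has_derivative_compose[OF MN.local_rep_has_derivative[OF c(1) d(1) c(2) d(2)] this]
  have "(local_rep c id e has_derivative
      (\<lambda>v. transition_derivative d e x (transition_derivative c d x v))) (at (chart_map c x))"
    by (rule has_derivative_transform_within_open[OF _ op xW eq])
  from frechet_derivative_at[OF this] show ?thesis
    unfolding transition_derivative_def[of c e] by (rule fun_cong[symmetric])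
qed

lemma transition_derivative_same:
  assumes "smooth_manifold N" "d \<in> atlas N" "x \<in> chart_dom d"
  shows "transition_derivative d d x v = v"
proof -
  have "open (chart_map d ` chart_dom d)"
    using assms open_chart_image[OF assms(1,2) chart_dom_open] by blast
  then have "(local_rep d id d has_derivative (\<lambda>v. v)) (at (chart_map d x))"
    using assms chart_inv_chart[OF assms(1,2)]
    by (intro has_derivative_transform_within_open[OF has_derivative_ident])
      (auto simp: local_rep_def)
  from frechet_derivative_at[OF this] show ?thesis
    by (simp add: transition_derivative_def fun_eq_iff)
qed

lemma transition_derivative_inverse:
  assumes "smooth_manifold N" "d \<in> atlas N" "x \<in> chart_dom d" "e \<in> atlas N" "x \<in> chart_dom e"
  shows "transition_derivative d e x (transition_derivative e d x v) = v"
proof -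
  have "v = transition_derivative e e x v"
    by (rule transition_derivative_same[OF assms(1,4,5), symmetric])
  also have "\<dots> = transition_derivative d e x (transition_derivative e d x v)"
    by (rule transition_derivative_compose[OF smooth_inclusion_refl[OF assms(1)]
        smooth_inclusion_refl[OF assms(1)] assms(4,5,2,3,4,5)])
  finally show ?thesis by (rule sym)
qed

text \<open>
  The tangent vector with given components in \<open>d\<close>, the inverse of \<^const>\<open>components\<close>.
\<close>

definition coord_vec ::
    "('a, 'e::euclidean_space) manifold \<Rightarrow> ('a, 'e) chart \<Rightarrow> 'a \<Rightarrow> 'e \<Rightarrow> 'e" where
  "coord_vec N d x = transition_derivative d (chart_at N x) x"

context
  fixes N :: "('a, 'e::euclidean_space) manifold" and d and x
  assumes N: "smooth_manifold N" and d: "d \<in> atlas N" "x \<in> chart_dom d"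
begin

lemma chart_dom_in_points: "x \<in> points N"
  using openin_subset[OF chart_dom_open[OF N d(1)]] d(2) by blast

lemma components_coord_vec: "components N x d (coord_vec N d x w) = w"
  unfolding components_eq coord_vec_def
  using chart_at[OF N chart_dom_in_points] by (intro transition_derivative_inverse[OF N] d)

lemma coord_vec_components: "coord_vec N d x (components N x d v) = v"
  unfolding components_eq coord_vec_def
  using chart_at[OF N chart_dom_in_points] by (intro transition_derivative_inverse[OF N] d)

lemma linear_coord_vec: "linear (coord_vec N d x)"
  unfolding coord_vec_def
  using chart_at[OF N chart_dom_in_points]
  by (intro smooth_inclusion.linear_transition_derivative[OF smooth_inclusion_refl[OF N]] d)

lemma coord_vec_expand: "coord_vec N d x w = (\<Sum>a\<in>Basis. (w \<bullet> a) *\<^sub>R coord_vec N d x a)"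
proof -
  have "coord_vec N d x w = coord_vec N d x (\<Sum>a\<in>Basis. (w \<bullet> a) *\<^sub>R a)"
    by (simp add: euclidean_representation)
  then show ?thesis by (simp add: linear_sum[OF linear_coord_vec] linear_cmul[OF linear_coord_vec])
qed

lemma inj_coord_vec: "inj (coord_vec N d x)"
  using components_coord_vec by (metis injI)

lemma components_coord_vec_transition:
  assumes "e \<in> atlas N" "x \<in> chart_dom e"
  shows "components N x e (coord_vec N d x w) = transition_derivative d e x w"
  unfolding components_eq coord_vec_def
  by (rule transition_derivative_compose[OF smooth_inclusion_refl[OF N] smooth_inclusion_refl[OF N] d
      chart_at[OF N chart_dom_in_points] assms, symmetric])

end

context smooth_inclusion
begin

lemma coord_vec_transition:
  assumes "c \<in> atlas M" "x \<in> chart_dom c" "d \<in> atlas N" "x \<in> chart_dom d"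
  shows "coord_vec N d x (transition_derivative c d x v) = transition_derivative c (chart_at N x) x v"
  unfolding coord_vec_def
  by (rule transition_derivative_compose[OF smooth_inclusion_axioms smooth_inclusion_refl[OF smooth_N]
      assms chart_at[OF smooth_N chart_dom_in_points[OF smooth_N assms(3,4)]], symmetric])

text \<open>
  Smoothness in one pair of charts suffices: in any other pair the components are obtained by
  composing with a change of coordinates of \<open>M\<close> and multiplying with the derivative of one of \<open>N\<close>.
\<close>

lemma smooth_alongI:
  assumes c: "c \<in> atlas M" and d: "d \<in> atlas N" and U: "openin (mtop M) U"
    and sub: "U \<subseteq> chart_dom c \<inter> chart_dom d"
    and v: "smooth_on (chart_map c ` U) v"
    and V: "\<And>x. x \<in> U \<Longrightarrow> V x = coord_vec N d x (v (chart_map c x))"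
  shows "smooth_along M N U V"
  unfolding smooth_along_def
proof (intro ballI)
  interpret MM: smooth_inclusion M M by (rule smooth_inclusion_refl[OF smooth_M])
  interpret NN: smooth_inclusion N N by (rule smooth_inclusion_refl[OF smooth_N])
  fix c' d' assume c': "c' \<in> atlas M" and d': "d' \<in> atlas N"
  let ?W = "U \<inter> chart_dom c' \<inter> chart_dom d'"
  let ?S = "chart_map c' ` ?W"
  have "openin (mtop M) ?W"
    using U c' d' by (intro openin_Int_chart_dom MM.openin_Int_chart_dom)
  then have S: "open ?S" by (rule open_chart_image[OF smooth_M c']) auto
  have smooth_c: "smooth_on ?S (local_rep c' id c)" and smooth_d: "smooth_on ?S (local_rep c' id d)"
    using sub by (auto intro!: smooth_on_subset[OF MM.smooth_local_rep[OF c' c]]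
        smooth_on_subset[OF smooth_local_rep[OF c' d]])
  have "smooth_on ?S (\<lambda>y. v (local_rep c' id c y))"
    using MM.local_rep_chart[OF c', of _ c]
    by (intro smooth_on_compose[OF S v smooth_c]) (auto simp: image_iff)
  moreover have "smooth_on ?S (\<lambda>y. frechet_derivative (local_rep d id d') (at (local_rep c' id d y)) a)"
    for a
    using local_rep_chart[OF c', of _ d] sub
    by (intro smooth_on_compose[OF S smooth_on_derivative[OF NN.smooth_local_rep[OF d d']] smooth_d])
      (auto simp: image_iff)
  ultimately have "smooth_on ?S (\<lambda>y. \<Sum>a\<in>Basis. (v (local_rep c' id c y) \<bullet> a) *\<^sub>R
      frechet_derivative (local_rep d id d') (at (local_rep c' id d y)) a)"
    using S by (intro smooth_on_sum smooth_on_scaleR smooth_on_inner smooth_on_const)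
  then show "smooth_on ?S (\<lambda>y. components N (chart_inv c' y) d' (V (chart_inv c' y)))"
  proof (rule smooth_on_cong[OF S, rotated])
    fix y assume "y \<in> ?S"
    then obtain x where y: "y = chart_map c' x" and x: "x \<in> ?W" by blast
    then have xc': "x \<in> chart_dom c'" by blast
    have "chart_inv c' y = x" unfolding y by (rule chart_inv_chart[OF smooth_M c' xc'])
    moreover have "local_rep c' id c y = chart_map c x" "local_rep c' id d y = chart_map d x"
      unfolding y by (rule MM.local_rep_chart[OF c' xc'] local_rep_chart[OF c' xc'])+
    moreover have "components N x d' (V x) = (\<Sum>a\<in>Basis. (v (chart_map c x) \<bullet> a) *\<^sub>R transition_derivative d d' x a)"
    proof -
      have lin: "linear (transition_derivative d d' x)"
        using x sub by (intro NN.linear_transition_derivative d d') auto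
      have "components N x d' (V x) = transition_derivative d d' x (v (chart_map c x))"
        using x sub V components_coord_vec_transition[OF smooth_N d _ d'] by auto
      also have "v (chart_map c x) = (\<Sum>a\<in>Basis. (v (chart_map c x) \<bullet> a) *\<^sub>R a)"
        by (simp add: euclidean_representation)
      finally show ?thesis by (simp add: linear_sum[OF lin] linear_cmul[OF lin])
    qed
    ultimately show "(\<Sum>a\<in>Basis. (v (local_rep c' id c y) \<bullet> a) *\<^sub>R
        frechet_derivative (local_rep d id d') (at (local_rep c' id d y)) a)
      = components N (chart_inv c' y) d' (V (chart_inv c' y))"
      by (simp add: transition_derivative_def)
  qed
qed

text \<open>
  The charts and the index set of the frame may depend on the point, only the rank may not.
\<close>

lemma smooth_subbundleI:
  assumes "\<And>x. x \<in> points M \<Longrightarrow> \<exists>c\<in>atlas M. \<exists>d\<in>atlas N. \<exists>U (I :: 'i set) B.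
    openin (mtop M) U \<and> x \<in> U \<and> U \<subseteq> chart_dom c \<inter> chart_dom d \<and> card I = k \<and>
    (\<forall>i\<in>I. smooth_on (chart_map c ` U) (B i)) \<and>
    (\<forall>y\<in>U. frame I (\<lambda>i. coord_vec N d y (B i (chart_map c y))) (E y))"
  shows "smooth_subbundle M N E"
  unfolding smooth_subbundle_def
proof (intro exI[of _ k] ballI)
  fix x assume x: "x \<in> points M"
  obtain c d U and I :: "'i set" and B where c: "c \<in> atlas M" and d: "d \<in> atlas N"
    and U: "openin (mtop M) U" "x \<in> U" "U \<subseteq> chart_dom c \<inter> chart_dom d" and card: "card I = k"
    and smooth: "\<And>i. i \<in> I \<Longrightarrow> smooth_on (chart_map c ` U) (B i)"
    and frame: "\<And>y. y \<in> U \<Longrightarrow> frame I (\<lambda>i. coord_vec N d y (B i (chart_map c y))) (E y)"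
    using assms[OF x] by blast
  have "finite I" using frame[OF U(2)] by (simp add: frame_def)
  then obtain \<sigma> where \<sigma>: "bij_betw \<sigma> {..<k} I"
    using ex_bij_betw_nat_finite[of I] card by (auto simp: lessThan_atLeast0)
  define F where "F i y = coord_vec N d y (B (\<sigma> i) (chart_map c y))" for i y
  have "smooth_along M N U (F i)" if "i < k" for i
    using that bij_betwE[OF \<sigma>] F_def by (intro smooth_alongI[OF c d U(1,3) smooth[of "\<sigma> i"]]) auto
  moreover have "inj_on (\<lambda>i. F i y) {..<k} \<and> independent ((\<lambda>i. F i y) ` {..<k}) \<and>
      span ((\<lambda>i. F i y) ` {..<k}) = E y" if "y \<in> U" for y
    using frame_imp_basis[OF frame_reindex[OF frame[OF that] \<sigma>]] by (simp add: F_def)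
  ultimately show "\<exists>U F. openin (mtop M) U \<and> x \<in> U \<and> (\<forall>i<k. smooth_along M N U (F i)) \<and>
      (\<forall>y\<in>U. inj_on (\<lambda>i. F i y) {..<k} \<and> independent ((\<lambda>i. F i y) ` {..<k}) \<and>
        span ((\<lambda>i. F i y) ` {..<k}) = E y)"
    using U by (intro exI[of _ U] exI[of _ F]) simp
qed

end


section \<open>Tensors along a submanifold\<close>

lemma smooth_coord_vec:
  assumes "smooth_manifold N" "d \<in> atlas N"
  shows "smooth_vector_field_on N (chart_dom d) (\<lambda>x. coord_vec N d x a)"
proof -
  interpret smooth_inclusion N N by (rule smooth_inclusion_refl[OF assms(1)])
  show ?thesis
    using chart_dom_open[OF assms] open_chart_image[OF assms chart_dom_open[OF assms]]
    by (intro smooth_alongI[OF assms(2,2), where v = "\<lambda>y. a"] smooth_on_const) auto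
qed

context smooth_inclusion
begin

context
  fixes c d U
  assumes c: "c \<in> atlas M" and d: "d \<in> atlas N" and U: "openin (mtop M) U"
    and U_sub: "U \<subseteq> chart_dom c \<inter> chart_dom d"
begin

lemma open_coord_image: "open (chart_map c ` U)"
  using open_chart_image[OF smooth_M c U] U_sub by blast

lemma smooth_on_pullback:
  assumes "smooth_on (chart_map d ` chart_dom d) f"
  shows "smooth_on (chart_map c ` U) (\<lambda>y. f (local_rep c id d y))"
  using U_sub local_rep_chart[OF c, of _ d]
  by (intro smooth_on_compose[OF open_coord_image assms] smooth_on_subset[OF smooth_local_rep[OF c d]])
    (auto simp: image_iff)

text \<open>
  The smoothness of \<open>J\<close> concerns fields on open subsets of \<open>N\<close>.  It is applied to the coordinate
  fields of \<open>d\<close>; a field along \<open>M\<close> is a combination of these with smooth coefficients, and the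
  components of their images are pulled back to \<open>M\<close>.
\<close>

lemma tensor_1_1_along:
  assumes J: "smooth_tensor_1_1 N J" and v: "smooth_on (chart_map c ` U) v"
  obtains w where "smooth_on (chart_map c ` U) w"
    "\<And>x. x \<in> U \<Longrightarrow> J x (coord_vec N d x (v (chart_map c x))) = coord_vec N d x (w (chart_map c x))"
proof -
  define A where "A = (\<lambda>a z. components N (chart_inv d z) d (J (chart_inv d z) (coord_vec N d (chart_inv d z) a)))"
  have "smooth_vector_field_on N (chart_dom d) (\<lambda>x. J x (coord_vec N d x a))" for a
    using J smooth_coord_vec[OF smooth_N d] chart_dom_open[OF smooth_N d]
    unfolding smooth_tensor_1_1_def by blast
  from this[unfolded smooth_along_def, THEN bspec[OF _ d], THEN bspec[OF _ d]]
  have A: "smooth_on (chart_map d ` chart_dom d) (A a)" for a by (simp add: A_def)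
  show thesis
  proof (rule that[of "\<lambda>y. \<Sum>a\<in>Basis. (v y \<bullet> a) *\<^sub>R A a (local_rep c id d y)"])
    show "smooth_on (chart_map c ` U) (\<lambda>y. \<Sum>a\<in>Basis. (v y \<bullet> a) *\<^sub>R A a (local_rep c id d y))"
      using open_coord_image v
      by (intro smooth_on_sum smooth_on_scaleR smooth_on_inner smooth_on_const smooth_on_pullback A)
    fix x assume x: "x \<in> U"
    then have xd: "x \<in> chart_dom d" and xN: "x \<in> points N" and xc: "x \<in> chart_dom c"
      using U_sub chart_dom_in_points[OF smooth_N d] by auto
    have J_lin: "linear (J x)" using J xN by (simp add: smooth_tensor_1_1_def)
    note X_lin = linear_coord_vec[OF smooth_N d xd]
    have "coord_vec N d x (A a (chart_map d x)) = J x (coord_vec N d x a)" for a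
      by (simp add: A_def chart_inv_chart[OF smooth_N d xd] coord_vec_components[OF smooth_N d xd])
    then show "J x (coord_vec N d x (v (chart_map c x))) = coord_vec N d x
        (\<Sum>a\<in>Basis. (v (chart_map c x) \<bullet> a) *\<^sub>R A a (local_rep c id d (chart_map c x)))"
      by (simp add: local_rep_chart[OF c xc] coord_vec_expand[OF smooth_N d xd, of "v (chart_map c x)"]
          linear_sum[OF J_lin] linear_cmul[OF J_lin] linear_sum[OF X_lin] linear_cmul[OF X_lin])
  qed
qed

text \<open>
  Contracting \<open>g\<close> with a smooth field along \<open>M\<close> gives a smooth family of linear forms; as for
  endomorphisms, the values on coordinate fields are pulled back from \<open>N\<close>.
\<close>

lemma tensor_0_2_along:
  assumes g: "smooth_tensor_0_2 N g" and v: "smooth_on (chart_map c ` U) v"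
  obtains \<alpha> where "smooth_on (chart_map c ` U) \<alpha>"
    "\<And>x w. x \<in> U \<Longrightarrow> g x (coord_vec N d x (v (chart_map c x))) (coord_vec N d x w) = \<alpha> (chart_map c x) \<bullet> w"
proof -
  define G where "G = (\<lambda>a b z. g (chart_inv d z) (coord_vec N d (chart_inv d z) a) (coord_vec N d (chart_inv d z) b))"
  have "smooth_function_on N (chart_dom d) (\<lambda>x. g x (coord_vec N d x a) (coord_vec N d x b))" for a b
    using g smooth_coord_vec[OF smooth_N d] chart_dom_open[OF smooth_N d]
    unfolding smooth_tensor_0_2_def by blast
  from this[unfolded smooth_function_on_def, THEN bspec[OF _ d]]
  have G: "smooth_on (chart_map d ` chart_dom d) (G a b)" for a b by (simp add: G_def o_def)
  let ?\<alpha> = "\<lambda>y. \<Sum>b\<in>Basis. (\<Sum>a\<in>Basis. (v y \<bullet> a) * G a b (local_rep c id d y)) *\<^sub>R b"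
  show thesis
  proof (rule that[of ?\<alpha>])
    show "smooth_on (chart_map c ` U) ?\<alpha>"
      using open_coord_image v
      by (intro smooth_on_sum smooth_on_scaleR smooth_on_mult smooth_on_inner smooth_on_const
          smooth_on_pullback G)
    fix x w assume x: "x \<in> U"
    then have xd: "x \<in> chart_dom d" and xN: "x \<in> points N" and xc: "x \<in> chart_dom c"
      using U_sub chart_dom_in_points[OF smooth_N d] by auto
    have g_bil: "bilinear (g x)" using g xN by (simp add: smooth_tensor_0_2_def)
    let ?v = "v (chart_map c x)"
    have "g x (coord_vec N d x ?v) (coord_vec N d x w) = (\<Sum>(a, b)\<in>Basis \<times> Basis.
        g x ((?v \<bullet> a) *\<^sub>R coord_vec N d x a) ((w \<bullet> b) *\<^sub>R coord_vec N d x b))"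
      by (subst (1 2) coord_vec_expand[OF smooth_N d xd]) (rule bilinear_sum[OF g_bil])
    also have "\<dots> = (\<Sum>a\<in>Basis. \<Sum>b\<in>Basis. (?v \<bullet> a) * G a b (chart_map d x) * (w \<bullet> b))"
      by (simp add: sum.cartesian_product G_def chart_inv_chart[OF smooth_N d xd]
          bilinear_lmul[OF g_bil] bilinear_rmul[OF g_bil] mult_ac)
    also have "\<dots> = (\<Sum>b\<in>Basis. (\<Sum>a\<in>Basis. (?v \<bullet> a) * G a b (chart_map d x)) * (w \<bullet> b))"
      by (subst sum.swap) (simp add: sum_distrib_right)
    also have "\<dots> = ?\<alpha> (chart_map c x) \<bullet> w"
      by (simp add: local_rep_chart[OF c xc] inner_sum_left inner_commute[of w])
    finally show "g x (coord_vec N d x ?v) (coord_vec N d x w) = ?\<alpha> (chart_map c x) \<bullet> w" .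
  qed
qed

end

end


section \<open>Totally real submanifolds\<close>

locale norden_submanifold = smooth_inclusion M N
  for M :: "('a, 'f::euclidean_space) manifold" and N :: "('a, 'e::euclidean_space) manifold" +
  fixes J :: "'a \<Rightarrow> 'e \<Rightarrow> 'e" and g :: "'a \<Rightarrow> 'e \<Rightarrow> 'e \<Rightarrow> real"
  assumes norden: "almost_complex_norden_manifold N J g"
    and immersion: "x \<in> points M \<Longrightarrow> inj (differential M N id x)"
begin

lemma tensor_J: "smooth_tensor_1_1 N J" and tensor_g: "smooth_tensor_0_2 N g"
  using norden by (simp_all add: almost_complex_norden_manifold_def almost_complex_structure_def
      semi_riemannian_metric_def)

lemma norden_space_at: "x \<in> points M \<Longrightarrow> norden_space (J x) (g x)"
  using norden points_subset
  by (auto simp: norden_space_def almost_complex_norden_manifold_def almost_complex_structure_def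
      semi_riemannian_metric_def smooth_tensor_1_1_def smooth_tensor_0_2_def)

lemma associated_metric_at: "x \<in> points M \<Longrightarrow> associated_metric J g x = norden_space.h (J x) (g x)"
  by (simp add: fun_eq_iff associated_metric_def norden_space.h_def[OF norden_space_at])

lemma inj_J: "x \<in> points M \<Longrightarrow> inj (J x)"
  using norden_space.J_J[OF norden_space_at] by (metis injI neg_equal_iff_equal)

text \<open>
  The tangent space, defined through the chosen chart of \<open>M\<close> at \<open>x\<close>, can be read off from any chart
  of \<open>M\<close> around \<open>x\<close>, since the two parametrizations differ by an invertible change of coordinates.
\<close>

lemma tangent_param:
  assumes c: "c \<in> atlas M" "x \<in> chart_dom c"
  defines "D \<equiv> transition_derivative c (chart_at N x) x"
  shows "linear D" "inj D" "tangent M N x = range D"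
proof -
  have x: "x \<in> points M" by (rule chart_dom_in_points[OF smooth_M c])
  then have xN: "x \<in> points N" using points_subset by blast
  note M_at = chart_at[OF smooth_M x] and N_at = chart_at[OF smooth_N xN]
  let ?A = "transition_derivative c (chart_at M x) x"
    and ?B = "transition_derivative (chart_at M x) c x"
  note refl = smooth_inclusion_refl[OF smooth_M]
  have D: "D v = differential M N id x (?A v)" for v
    unfolding D_def differential_id_eq
    by (rule transition_derivative_compose[OF refl smooth_inclusion_axioms c M_at N_at])
  have AB: "?A (?B v) = v" and BA: "?B (?A v) = v" for v
    by (rule transition_derivative_inverse[OF smooth_M c M_at]
        transition_derivative_inverse[OF smooth_M M_at c])+
  show "linear D"
    unfolding D_def by (rule linear_transition_derivative[OF c(1) N_at(1) c(2) N_at(2)])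
  show "inj D"
  proof (rule injI)
    fix v w assume "D v = D w"
    then have "?A v = ?A w" by (simp add: D inj_eq[OF immersion[OF x]])
    then have "?B (?A v) = ?B (?A w)" by simp
    then show "v = w" by (simp only: BA)
  qed
  have "differential M N id x v = D (?B v)" for v by (simp add: D AB)
  then show "tangent M N x = range D"
    unfolding tangent_def
  proof (intro equalityI image_subsetI)
    show "D v \<in> range (differential M N id x)" for v unfolding D by (rule rangeI)
  qed simp
qed

lemma tangent_frame:
  assumes "c \<in> atlas M" "x \<in> chart_dom c" "d \<in> atlas N" "x \<in> chart_dom d"
  shows "frame Basis (\<lambda>b. coord_vec N d x (transition_derivative c d x b)) (tangent M N x)"
  unfolding coord_vec_transition[OF assms] tangent_param(3)[OF assms(1,2)]
  by (rule frame_linear_image[OF frame_Basis tangent_param(1,2)[OF assms(1,2)]])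

lemma subspace_tangent:
  assumes "x \<in> points M"
  shows "subspace (tangent M N x)"
  using tangent_param[OF chart_at[OF smooth_M assms]] linear_subspace_image[OF _ subspace_UNIV] by metis

lemma dim_tangent:
  assumes "x \<in> points M"
  shows "dim (tangent M N x) = DIM('f)"
  using tangent_param[OF chart_at[OF smooth_M assms]] dim_image_eq[of _ UNIV] by (metis dim_UNIV span_UNIV)

lemma chart_overlap:
  assumes "x \<in> points M"
  obtains c d U where "c \<in> atlas M" "d \<in> atlas N" "openin (mtop M) U" "x \<in> U"
    "U = chart_dom c \<inter> chart_dom d"
proof -
  have xN: "x \<in> points N" using assms points_subset by blast
  note M_at = chart_at[OF smooth_M assms] and N_at = chart_at[OF smooth_N xN]
  show thesis
    using that[OF M_at(1) N_at(1) openin_Int_chart_dom[OF chart_dom_open[OF smooth_M M_at(1)] N_at(1)]]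
      M_at N_at by blast
qed

text \<open>
  The columns \<open>\<tau> b\<close> of the Jacobian matrix of the inclusion are a smooth frame of the tangent bundle
  in coordinates; the \<open>\<sigma> b\<close> are the components of its image under \<open>J\<close>.
\<close>

lemma smooth_tangent_frames:
  assumes c: "c \<in> atlas M" and d: "d \<in> atlas N" and U: "openin (mtop M) U"
    and sub: "U = chart_dom c \<inter> chart_dom d"
  obtains \<tau> \<sigma> :: "'f \<Rightarrow> 'f \<Rightarrow> 'e" where
    "\<And>b. smooth_on (chart_map c ` U) (\<tau> b)" "\<And>b. smooth_on (chart_map c ` U) (\<sigma> b)"
    "\<And>x. x \<in> U \<Longrightarrow> frame Basis (\<lambda>b. coord_vec N d x (\<tau> b (chart_map c x))) (tangent M N x)"
    "\<And>x b. x \<in> U \<Longrightarrow> J x (coord_vec N d x (\<tau> b (chart_map c x))) = coord_vec N d x (\<sigma> b (chart_map c x))"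
proof -
  have U_sub: "U \<subseteq> chart_dom c \<inter> chart_dom d" using sub by simp
  define \<tau> where "\<tau> = (\<lambda>b y. frechet_derivative (local_rep c id d) (at y) b)"
  have \<tau>: "smooth_on (chart_map c ` U) (\<tau> b)" for b
    unfolding \<tau>_def sub by (rule smooth_on_derivative[OF smooth_local_rep[OF c d]])
  have "\<exists>\<sigma>. smooth_on (chart_map c ` U) \<sigma> \<and>
      (\<forall>x\<in>U. J x (coord_vec N d x (\<tau> b (chart_map c x))) = coord_vec N d x (\<sigma> (chart_map c x)))" for b
    using tensor_1_1_along[OF c d U U_sub tensor_J \<tau>[of b]] by metis
  then obtain \<sigma> where "\<And>b. smooth_on (chart_map c ` U) (\<sigma> b)"
    "\<And>b x. x \<in> U \<Longrightarrow> J x (coord_vec N d x (\<tau> b (chart_map c x))) = coord_vec N d x (\<sigma> b (chart_map c x))"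
    by metis
  moreover have "frame Basis (\<lambda>b. coord_vec N d x (\<tau> b (chart_map c x))) (tangent M N x)" if "x \<in> U" for x
    using tangent_frame[OF c _ d, of x] that sub by (simp add: \<tau>_def transition_derivative_def)
  ultimately show thesis using that \<tau> by blast
qed

lemma smooth_subbundle_J_tangent: "smooth_subbundle M N (\<lambda>x. J x ` tangent M N x)"
proof (rule smooth_subbundleI[where k = "DIM('f)"])
  fix x assume "x \<in> points M"
  then obtain c d U where c: "c \<in> atlas M" and d: "d \<in> atlas N" and U: "openin (mtop M) U" "x \<in> U"
    and sub: "U = chart_dom c \<inter> chart_dom d"
    by (rule chart_overlap)
  obtain \<tau> \<sigma> :: "'f \<Rightarrow> 'f \<Rightarrow> 'e" where \<sigma>: "\<And>b. smooth_on (chart_map c ` U) (\<sigma> b)"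
    and frame: "\<And>x. x \<in> U \<Longrightarrow> frame Basis (\<lambda>b. coord_vec N d x (\<tau> b (chart_map c x))) (tangent M N x)"
    and J_\<tau>: "\<And>x b. x \<in> U \<Longrightarrow> J x (coord_vec N d x (\<tau> b (chart_map c x))) = coord_vec N d x (\<sigma> b (chart_map c x))"
    using smooth_tangent_frames[OF c d U(1) sub] by metis
  have "frame Basis (\<lambda>b. coord_vec N d y (\<sigma> b (chart_map c y))) (J y ` tangent M N y)" if "y \<in> U" for y
  proof -
    have y: "y \<in> points M" using openin_subset[OF U(1)] that by blast
    show ?thesis
      using frame_linear_image[OF frame[OF that] norden_space.linear_J[OF norden_space_at[OF y]] inj_J[OF y]]
      by (simp add: J_\<tau>[OF that])
  qed
  then show "\<exists>c\<in>atlas M. \<exists>d\<in>atlas N. \<exists>U (I :: 'f set) B. openin (mtop M) U \<and> x \<in> U \<and>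
      U \<subseteq> chart_dom c \<inter> chart_dom d \<and> card I = DIM('f) \<and> (\<forall>i\<in>I. smooth_on (chart_map c ` U) (B i)) \<and>
      (\<forall>y\<in>U. frame I (\<lambda>i. coord_vec N d y (B i (chart_map c y))) (J y ` tangent M N y))"
    using U sub \<sigma>
    by (intro bexI[OF _ c] bexI[OF _ d] exI[of _ U] exI[of _ "Basis :: 'f set"] exI[of _ \<sigma>]) simp
qed

text \<open>
  The forms in question are \<open>g (J (V i))\<close> and \<open>g (V i)\<close>.  A combination of them is \<open>g (J p + q)\<close> for tangent vectors \<open>p\<close> and \<open>q\<close>.  If it is
  zero, then \<open>q = J (- p)\<close> lies in the intersection of the tangent space with its image under \<open>J\<close>,
  which is trivial.
\<close>

lemma totally_real_normal_forms_independent: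
  assumes tr: "totally_real M N J g" and x: "x \<in> points M"
    and frame: "frame I V (tangent M N x)"
    and zero: "\<And>u. (\<Sum>i\<in>I. a (Inl i) * g x (J x (V i)) u) + (\<Sum>i\<in>I. a (Inr i) * g x (V i) u) = 0"
  shows "\<forall>j\<in>I <+> I. a j = (0::real)"
proof -
  interpret norden_space "J x" "g x" by (rule norden_space_at[OF x])
  let ?p = "\<Sum>i\<in>I. a (Inl i) *\<^sub>R V i" and ?q = "\<Sum>i\<in>I. a (Inr i) *\<^sub>R V i"
  have T: "?p \<in> tangent M N x" "?q \<in> tangent M N x" using frame by (auto simp: frame_def)
  have lin: "linear (\<lambda>v. g x v u)" for u using bilinear_g by (simp add: bilinear_def)
  have "g x (J x ?p + ?q) u = 0" for u
    using zero[of u]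
    by (simp add: linear_add[OF lin] linear_sum[OF lin] linear_cmul[OF lin] linear_sum[OF linear_J]
        linear_cmul[OF linear_J])
  then have sum: "J x ?p + ?q = 0" using g_nondegenerate by (auto simp: nondegenerate_on_def)
  have "?q = - J x ?p" using sum by (simp add: eq_neg_iff_add_eq_0 add.commute)
  also have "\<dots> = J x (- ?p)" by (rule linear_neg[OF linear_J, symmetric])
  finally have "?q = J x (- ?p)" .
  moreover have "- ?p \<in> tangent M N x" using T(1) subspace_tangent[OF x] subspace_neg by blast
  ultimately have "?q \<in> tangent M N x \<inter> J x ` tangent M N x" using T(2) by blast
  moreover have "tangent M N x \<inter> J x ` tangent M N x \<subseteq> {0}"
    using tr x unfolding totally_real_def by (intro totally_real_Int_J) auto
  ultimately have q: "?q = 0" by blast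
  then have "J x (J x ?p) = 0" using sum linear_0[OF linear_J] by simp
  then have p: "?p = 0" by simp
  show ?thesis
    using frame_coeff_zero[OF frame, of "\<lambda>i. a (Inl i)"] frame_coeff_zero[OF frame, of "\<lambda>i. a (Inr i)"] p q
    by auto
qed

text \<open>
  The pairings of \<open>u\<close> with \<open>V i\<close> and \<open>J (V i)\<close> under the associated metric are, up to sign, its
  pairings with \<open>J (V i)\<close> and \<open>V i\<close> under \<open>g\<close>.
\<close>

lemma orth_tangent_J_iff:
  assumes x: "x \<in> points M" and frame: "frame I V (tangent M N x)"
  shows "u \<in> orth (associated_metric J g x) (tangent M N x \<union> J x ` tangent M N x) \<longleftrightarrow>
    (\<forall>i\<in>I. g x (J x (V i)) u = 0 \<and> g x (V i) u = 0)" (is "?L \<longleftrightarrow> ?R")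
proof -
  interpret norden_space "J x" "g x" by (rule norden_space_at[OF x])
  have lin: "linear (\<lambda>v. g x v u)" using bilinear_g by (simp add: bilinear_def)
  have "?L \<longleftrightarrow> (\<forall>t\<in>tangent M N x. h u t = 0 \<and> h u (J x t) = 0)"
    unfolding orth_def associated_metric_at[OF x] by blast
  also have "\<dots> \<longleftrightarrow> (\<forall>t\<in>tangent M N x. g x (J x t) u = 0 \<and> g x t u = 0)"
  proof -
    have "h u t = g x (J x t) u" for t using h_commute[of u t] by (simp only: h_def)
    moreover have "h u (J x t) = - g x t u" for t
      using h_J_right[of u t] g_commute[of u t] by simp
    ultimately show ?thesis by simp
  qed
  finally have L: "?L \<longleftrightarrow> (\<forall>t\<in>tangent M N x. g x (J x t) u = 0 \<and> g x t u = 0)" .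
  show ?thesis
    unfolding L
  proof (intro iffI ballI)
    fix i assume "\<forall>t\<in>tangent M N x. g x (J x t) u = 0 \<and> g x t u = 0" "i \<in> I"
    moreover have "V i \<in> span (V ` I)" using \<open>i \<in> I\<close> by (intro span_base imageI)
    then have "V i \<in> tangent M N x" by (simp only: frame_imp_basis(3)[OF frame])
    ultimately show "g x (J x (V i)) u = 0 \<and> g x (V i) u = 0" by blast
  next
    fix t assume R: ?R and "t \<in> tangent M N x"
    then obtain a where "t = (\<Sum>i\<in>I. a i *\<^sub>R V i)" using frame unfolding frame_def by blast
    then show "g x (J x t) u = 0 \<and> g x t u = 0"
      using R by (simp add: linear_sum[OF lin] linear_cmul[OF lin] linear_sum[OF linear_J]
          linear_cmul[OF linear_J])
  qed
qed

text \<open>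
  By the two preceding lemmas this is the common kernel of \<open>2 m\<close> independent smooth forms, to which
  \<open>kernel_frame\<close> applies in coordinates.
\<close>

lemma smooth_subbundle_orth_tangent_J:
  assumes tr: "totally_real M N J g"
  shows "smooth_subbundle M N (\<lambda>x. orth (associated_metric J g x) (tangent M N x \<union> J x ` tangent M N x))"
    (is "smooth_subbundle M N ?S")
proof (rule smooth_subbundleI[where k = "DIM('e) - 2 * DIM('f)"])
  fix x assume x: "x \<in> points M"
  then obtain c d U where c: "c \<in> atlas M" and d: "d \<in> atlas N" and U: "openin (mtop M) U" "x \<in> U"
    and sub: "U = chart_dom c \<inter> chart_dom d"
    by (rule chart_overlap)
  have U_sub: "U \<subseteq> chart_dom c \<inter> chart_dom d" using sub by simp
  obtain \<tau> \<sigma> :: "'f \<Rightarrow> 'f \<Rightarrow> 'e" where \<tau>: "\<And>b. smooth_on (chart_map c ` U) (\<tau> b)"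
    and \<sigma>: "\<And>b. smooth_on (chart_map c ` U) (\<sigma> b)"
    and frame: "\<And>x. x \<in> U \<Longrightarrow> frame Basis (\<lambda>b. coord_vec N d x (\<tau> b (chart_map c x))) (tangent M N x)"
    and J_\<tau>: "\<And>x b. x \<in> U \<Longrightarrow> J x (coord_vec N d x (\<tau> b (chart_map c x))) = coord_vec N d x (\<sigma> b (chart_map c x))"
    using smooth_tangent_frames[OF c d U(1) sub] by metis
  have form: "\<exists>\<alpha>. smooth_on (chart_map c ` U) \<alpha> \<and> (\<forall>x\<in>U. \<forall>w.
      g x (coord_vec N d x (v (chart_map c x))) (coord_vec N d x w) = \<alpha> (chart_map c x) \<bullet> w)"
    if "smooth_on (chart_map c ` U) v" for v
    using tensor_0_2_along[OF c d U(1) U_sub tensor_g that] by metis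
  obtain \<beta> where \<beta>: "\<And>b. smooth_on (chart_map c ` U) (\<beta> b)"
    and \<beta>_eq: "\<And>b x w. x \<in> U \<Longrightarrow>
      g x (coord_vec N d x (\<sigma> b (chart_map c x))) (coord_vec N d x w) = \<beta> b (chart_map c x) \<bullet> w"
    using form[OF \<sigma>] by metis
  obtain \<gamma> where \<gamma>: "\<And>b. smooth_on (chart_map c ` U) (\<gamma> b)"
    and \<gamma>_eq: "\<And>b x w. x \<in> U \<Longrightarrow>
      g x (coord_vec N d x (\<tau> b (chart_map c x))) (coord_vec N d x w) = \<gamma> b (chart_map c x) \<bullet> w"
    using form[OF \<tau>] by metis
  \<comment> \<open>The left summand of the index set carries the forms of \<open>J T\<close>, the right one those of \<open>T\<close>.\<close>
  define \<alpha> where "\<alpha> = case_sum \<beta> \<gamma>"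
  let ?K = "(Basis :: 'f set) <+> (Basis :: 'f set)"
  have surj: "\<exists>w. u = coord_vec N d y w" if "y \<in> U" for u y
    using that sub coord_vec_components[OF smooth_N d] by (metis IntD2)
  have indep: "\<forall>j\<in>?K. a j = 0" if zero: "(\<Sum>j\<in>?K. a j *\<^sub>R \<alpha> j (chart_map c x)) = 0" for a
  proof (rule totally_real_normal_forms_independent[OF tr x frame[OF U(2)]])
    fix u
    obtain w where u: "u = coord_vec N d x w" using surj[OF U(2)] by blast
    have "(\<Sum>j\<in>?K. a j *\<^sub>R \<alpha> j (chart_map c x)) \<bullet> w = 0" by (simp add: zero)
    then show "(\<Sum>b\<in>Basis. a (Inl b) * g x (J x (coord_vec N d x (\<tau> b (chart_map c x)))) u) +
        (\<Sum>b\<in>Basis. a (Inr b) * g x (coord_vec N d x (\<tau> b (chart_map c x))) u) = 0"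
      by (simp add: sum.Plus \<alpha>_def u J_\<tau>[OF U(2)] \<beta>_eq[OF U(2)] \<gamma>_eq[OF U(2)]
          inner_add_left inner_sum_left)
  qed
  have \<alpha>: "smooth_on (chart_map c ` U) (\<alpha> j)" for j
    using \<beta> \<gamma> by (cases j) (simp_all add: \<alpha>_def)
  have "\<exists>\<Omega> (I :: 'e set) B. open \<Omega> \<and> chart_map c x \<in> \<Omega> \<and> \<Omega> \<subseteq> chart_map c ` U \<and>
      card I + card ?K = DIM('e) \<and> (\<forall>i\<in>I. smooth_on \<Omega> (B i)) \<and>
      (\<forall>y\<in>\<Omega>. frame I (\<lambda>i. B i y) {w. \<forall>j\<in>?K. \<alpha> j y \<bullet> w = 0})"
    using indep
    by (rule kernel_frame[OF finite_Plus[OF finite_Basis finite_Basis]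
        open_coord_image[OF c d U(1) U_sub] imageI[OF U(2)] \<alpha>])
  then obtain \<Omega> and I :: "'e set" and B where \<Omega>: "open \<Omega>" "chart_map c x \<in> \<Omega>"
    and card: "card I + card ?K = DIM('e)" and B: "\<forall>i\<in>I. smooth_on \<Omega> (B i)"
    and kernel: "\<forall>y\<in>\<Omega>. frame I (\<lambda>i. B i y) {w. \<forall>j\<in>?K. \<alpha> j y \<bullet> w = 0}"
    by (elim exE conjE) (rule that)
  define U' where "U' = {y \<in> chart_dom c. chart_map c y \<in> \<Omega>} \<inter> U"
  have "frame I (\<lambda>i. coord_vec N d y (B i (chart_map c y))) (?S y)" if y: "y \<in> U'" for y
  proof -
    have yU: "y \<in> U" and y\<Omega>: "chart_map c y \<in> \<Omega>" and yd: "y \<in> chart_dom d" and yM: "y \<in> points M"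
      using y sub openin_subset[OF U(1)] by (auto simp: U'_def)
    have S_iff: "coord_vec N d y w \<in> ?S y \<longleftrightarrow> (\<forall>j\<in>?K. \<alpha> j (chart_map c y) \<bullet> w = 0)" for w
      unfolding orth_tangent_J_iff[OF yM frame[OF yU]] J_\<tau>[OF yU] \<beta>_eq[OF yU] \<gamma>_eq[OF yU]
      by (simp add: \<alpha>_def Plus_def ball_Un ball_conj_distrib)
    have "coord_vec N d y ` {w. \<forall>j\<in>?K. \<alpha> j (chart_map c y) \<bullet> w = 0} = ?S y"
    proof (intro equalityI subsetI)
      fix u assume "u \<in> ?S y"
      moreover obtain w where "u = coord_vec N d y w" using surj[OF yU] by blast
      ultimately show "u \<in> coord_vec N d y ` {w. \<forall>j\<in>?K. \<alpha> j (chart_map c y) \<bullet> w = 0}"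
        using S_iff by simp
    qed (use S_iff in \<open>auto simp only: image_iff mem_Collect_eq\<close>)
    then show ?thesis
      using frame_linear_image[OF bspec[OF kernel y\<Omega>] linear_coord_vec[OF smooth_N d yd] inj_coord_vec[OF smooth_N d yd]]
      by simp
  qed
  moreover have "openin (mtop M) U'"
    unfolding U'_def using openin_chart_preimage[OF smooth_M c \<Omega>(1)] U(1) by (rule openin_Int)
  moreover have "smooth_on (chart_map c ` U') (B i)" if "i \<in> I" for i
    by (rule smooth_on_subset[OF bspec[OF B that]]) (auto simp: U'_def)
  moreover have "card I = DIM('e) - 2 * DIM('f)"
    using card by (simp add: card_Plus)
  moreover have "x \<in> U'" using U(2) sub \<Omega>(2) by (simp add: U'_def)
  moreover have "U' \<subseteq> chart_dom c \<inter> chart_dom d" using sub by (auto simp: U'_def)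
  ultimately show "\<exists>c\<in>atlas M. \<exists>d\<in>atlas N. \<exists>U (I :: 'e set) B. openin (mtop M) U \<and> x \<in> U \<and>
      U \<subseteq> chart_dom c \<inter> chart_dom d \<and> card I = DIM('e) - 2 * DIM('f) \<and>
      (\<forall>i\<in>I. smooth_on (chart_map c ` U) (B i)) \<and>
      (\<forall>y\<in>U. frame I (\<lambda>i. coord_vec N d y (B i (chart_map c y))) (?S y))"
    by (intro bexI[OF _ c] bexI[OF _ d] exI[of _ U'] exI[of _ I] exI[of _ B]) simp
qed

text \<open>
  The radical has full dimension exactly when the associated metric vanishes on the tangent space.
\<close>

lemma dim_radical_iff:
  assumes x: "x \<in> points M"
  shows "dim (radical M N (associated_metric J g) x) = mdim M \<longleftrightarrow>
    J x ` tangent M N x \<subseteq> orth (g x) (tangent M N x)"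
proof -
  interpret norden_space "J x" "g x" by (rule norden_space_at[OF x])
  let ?T = "tangent M N x"
  have rad: "radical M N (associated_metric J g) x = ?T \<inter> orth h ?T"
    by (simp add: radical_def tangent_orth_def associated_metric_at[OF x])
  have "subspace (?T \<inter> orth h ?T)"
    using subspace_tangent[OF x] subspace_orth[OF bilinear_h] subspace_inter by blast
  then have "dim (?T \<inter> orth h ?T) = dim ?T \<longleftrightarrow> ?T \<inter> orth h ?T = ?T"
    using subspace_dim_equal[OF _ subspace_tangent[OF x], of "?T \<inter> orth h ?T"] by auto
  also have "\<dots> \<longleftrightarrow> ?T \<subseteq> orth h ?T" by blast
  finally show ?thesis
    by (simp add: rad mdim_def dim_tangent[OF x] isotropic_iff_J_orth)
qed

text \<open>
  The common core of both parts of the theorem, free of any relation between the dimensions.  The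
  screen transversal bundle that works is the orthogonal bundle of \<open>TM + J(TM)\<close>; it is zero in
  the Lagrangian case.
\<close>

lemma totally_real_iff:
  "totally_real M N J g \<longleftrightarrow>
    (\<forall>x\<in>points M. dim (radical M N (associated_metric J g) x) = mdim M) \<and>
    J_tangent_is_ltr M N J (associated_metric J g)"
proof (intro iffI conjI ballI; (elim conjE)?)
  assume tr: "totally_real M N J g"
  then have T: "nondegenerate_on (g x) (tangent M N x)"
      "J x ` tangent M N x \<subseteq> orth (g x) (tangent M N x)" if "x \<in> points M" for x
    using that by (auto simp: totally_real_def)
  show "dim (radical M N (associated_metric J g) x) = mdim M" if "x \<in> points M" for x
    using dim_radical_iff T(2) that by blast
  let ?S = "\<lambda>x. orth (associated_metric J g x) (tangent M N x \<union> J x ` tangent M N x)"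
  let ?L = "\<lambda>x. J x ` tangent M N x"
  have "complement_in (?S x) (tangent M N x) (tangent_orth M N (associated_metric J g) x) \<and>
      complement_in (?L x) (tangent M N x) (orth (associated_metric J g x) (?S x)) \<and>
      (\<forall>v\<in>?L x. \<forall>w\<in>?L x. associated_metric J g x v w = 0)" if x: "x \<in> points M" for x
  proof -
    interpret norden_space "J x" "g x" by (rule norden_space_at[OF x])
    show ?thesis
      unfolding tangent_orth_def associated_metric_at[OF x]
      using totally_real_complements[OF subspace_tangent[OF x] T[OF x]] by blast
  qed
  then have "screen_transversal M N (associated_metric J g) ?S"
    "lightlike_transversal M N (associated_metric J g) ?S ?L"
    unfolding screen_transversal_def lightlike_transversal_def
    using smooth_subbundle_orth_tangent_J[OF tr] smooth_subbundle_J_tangent by auto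
  then show "J_tangent_is_ltr M N J (associated_metric J g)"
    unfolding J_tangent_is_ltr_def by blast
next
  assume rad: "\<forall>x\<in>points M. dim (radical M N (associated_metric J g) x) = mdim M"
    and ltr: "J_tangent_is_ltr M N J (associated_metric J g)"
  from ltr obtain S where S: "\<And>x. x \<in> points M \<Longrightarrow>
      complement_in (S x) (tangent M N x) (orth (associated_metric J g x) (tangent M N x)) \<and>
      complement_in (J x ` tangent M N x) (tangent M N x) (orth (associated_metric J g x) (S x))"
    unfolding J_tangent_is_ltr_def screen_transversal_def lightlike_transversal_def tangent_orth_def
    by metis
  show "totally_real M N J g"
    unfolding totally_real_def
  proof (intro ballI conjI)
    fix x assume x: "x \<in> points M"
    interpret norden_space "J x" "g x" by (rule norden_space_at[OF x])
    show "J x ` tangent M N x \<subseteq> orth (g x) (tangent M N x)" using rad dim_radical_iff[OF x] x by blast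
    show "nondegenerate_on (g x) (tangent M N x)"
      using nondegenerate_if_complements[OF subspace_tangent[OF x], of "S x"] S[OF x]
      by (simp add: associated_metric_at[OF x])
  qed
qed

end

theorem theorem3p3:
  fixes N :: "('a, 'e::euclidean_space) manifold"
    and J :: "'a \<Rightarrow> 'e \<Rightarrow> 'e"
    and g :: "'a \<Rightarrow> 'e \<Rightarrow> 'e \<Rightarrow> real"
    and M :: "('a, 'f::euclidean_space) manifold"
    and n m :: nat
  assumes "almost_complex_norden_manifold N J g" and "mdim N = 2 * n"
    and "submanifold M N" and "mdim M = m" and "m > 1"
  shows "(1 < m \<and> m < n \<longrightarrow>
            (totally_real M N J g \<longleftrightarrow>
               isotropic M N (associated_metric J g) \<and>
               J_tangent_is_ltr M N J (associated_metric J g))) \<and>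
         (lagrangian M N J g \<longleftrightarrow>
               totally_lightlike M N (associated_metric J g) \<and>
               J_tangent_is_ltr M N J (associated_metric J g))"
proof -
  interpret norden_submanifold M N J g
    using assms(1,3)
    by (simp add: norden_submanifold_def norden_submanifold_axioms_def smooth_inclusion_def
        submanifold_def almost_complex_norden_manifold_def)
  let ?rad = "\<forall>x\<in>points M. dim (radical M N (associated_metric J g) x) = mdim M"
  have "isotropic M N (associated_metric J g) \<longleftrightarrow> ?rad" if "m < n"
    using assms that by (auto simp: isotropic_def lightlike_def codim_def)
  moreover have "totally_lightlike M N (associated_metric J g) \<longleftrightarrow> ?rad \<and> m = n"
    using assms by (auto simp: totally_lightlike_def lightlike_def codim_def)
  moreover have "lagrangian M N J g \<longleftrightarrow> totally_real M N J g \<and> m = n"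
    using assms by (auto simp: lagrangian_def)
  ultimately show ?thesis using totally_real_iff by blast
qed

end
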